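(* Consider the randomized block proximal-gradient method $x^{k+1}=T_{i_k}(x^k;\alpha_k)$, $k\ge0$, for minimizing $H=F+R$ on $\mathbb R^d=\mathbb R^{d_1}\times\cdots\times\mathbb R^{d_m}$. Suppose that $H$ is coercive, convex, definable and has a locally Lipschitz continuous gradient; that the blockwise regularity assumption holds; that $$0<\alpha_k\le\bar\alpha<\min\Big\{2,\min_{i\in[m]}\frac{\widehat L_i}{\varrho_i}\Big\}\quad\forall k\ge0,\qquad\sum_{k=0}^\infty\alpha_k=+\infty;$$ and that, for some $\rho>0$, $\mathbb P(i_k=i\mid\mathcal F_k)\ge\rho$ for all $i\in[m]$, $k\ge0$. Let $H^*:=\min H$, $S:=\{x:H(x)\le H(x^0)\}$, and let $\varphi$ be a global KL desingularization function of $H$. Fix $t_0>0$ and define $\phi(0):=0$ and, for $t>0$, $$\phi(t):=\frac1{(\varphi'(t))^2},\qquad\psi(t):=\int_t^{t_0}(\varphi'(s))^2\,ds .$$ Then $1/\sqrt\phi$ is integrable near zero, whereas $1/\phi$ is not integrable near zero. Consequently, with $$c_1=\Big(1-\frac{\bar\alpha}2\Big)\min_{i\in[m]}\widehat L_i,\quad c_2=\rho\min_{i\in[m]}\frac1{(\widehat L_i+\bar\alpha L_i^R)^2},\quad c_3=\max_{i\in[m]}\frac1{(\widehat L_i-\bar\alpha\varrho_i)^2},$$ $\mathfrak h:=\frac{1-\log2}2$ and $A_k:=\sum_{i=0}^{k-1}\alpha_i$: (i) For all $k\ge1$, $$\mathbb E[H(x^k)-H^*]\le\exp\Big(-\mathfrak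 h\frac{c_2}{c_3\bar\alpha}A_k\Big)(H(x^0)-H^* )+\psi^{-1}\Big(\psi(H(x^0)-H^* )+\frac{c_1c_2}2A_k\Big),$$ and there exists a random variable $x^*$ such that $x^k\to x^*$ almost surely and in $L^1$, $x^*\in\arg\min_{x\in S}H(x)$ almost surely, and $$\mathbb E[\|x^k-x^*\|]\le\frac{\sqrt{c_3}}{c_1c_2}\,\varphi\big(\mathbb E[H(x^k)-H^*]\big)\qquad\forall k\ge0.$$ (ii) There exist almost surely finite random indices $K_2,K_3$ such that, almost surely, $$H(x^k)-H^*\le\psi^{-1}\Big(\frac{c_1c_2}2A_k\Big)\quad\forall k\ge K_2,\qquad \|x^k-x^*\|\le\frac{\sqrt2}{c_1\sqrt{c_2}}\,\varphi\Big(\psi^{-1}\Big(\frac{c_1c_2}2A_k\Big)\Big)\quad\forall k\ge K_3 .$$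
   Context: Setting. $(\Omega,\mathcal F,\{\mathcal F_k\}_{k\ge0},\mathbb P)$ is a filtered probability space, $x^0$ and $\{\alpha_k\}$ are deterministic, and $i_k\in[m]=\{1,\dots,m\}$ is the ($\mathcal F_{k+1}$-measurable) random block sampled at iteration $k$. $F,R\in C^1(\mathbb R^d)$, $x=(x_1,\dots,x_m)$, $I_i:\mathbb R^{d_i}\to\mathbb R^d$ is the canonical embedding into the $i$th block, and $\nabla_iG:=I_i^\top\nabla G$. Blockwise regularity assumption. For each $i\in[m]$ there are constants $L_i^F,L_i^R>0$, $\varrho_i\ge0$ such that: (a) $F(x+I_iu_i)\le F(x)+\langle\nabla_iF(x),u_i\rangle+\frac{L_i^F}2\|u_i\|^2$ for all $x\in\mathbb R^d$, $u_i\in\mathbb R^{d_i}$; (b) for every fixed $(x_j)_{j\ne i}$, the function $u_i\mapsto R(x_1,\dots,x_{i-1},u_i,x_{i+1},\dots,x_m)+\frac{\varrho_i}2\|u_i\|^2$ is convex; (c) $\|\nabla_iR(x+I_iu_i)-\nabla_iR(x)\|\le L_i^R\|u_i\|$ whenever $x,x+I_iu_i\in S:=\{x:H(x)\le H(x^0)\}$. Put $\widehat L_i:=L_i^F+\varrho_i$, with $\widehat L_i/\varrho_i:=+\infty$ if $\varrho_i=0$. The map $T_i(x;\alpha)$ replaces the $i$th block $x_i$ of $x$ by $$T_i^b(x;\alpha)=\arg\min_{u_i\in\mathbb R^{d_i}}\Big\{R(x+I_i(u_i-x_i))+\langle\nabla_iF(x),u_i-x_i\rangle+\frac{\widehat L_i}{2\alpha}\|u_i-x_i\|^2\Big\}$$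 (a unique minimizer for $\alpha\in(0,\bar\alpha]$), leaving the other blocks unchanged. "Definable" means definable in a fixed o-minimal structure over the real field. Global KL desingularization function of $H$: a continuous concave function $\varphi:\mathbb R_+\to\mathbb R_+$ with $\varphi(0)=0$, continuously differentiable on $(0,+\infty)$ with $\varphi'>0$ there, such that $\varphi'(H(x)-H^* )\,\|\nabla H(x)\|\ge1$ for all $x\notin\arg\min H$. (It is a known theorem that one exists for every convex, definable, coercive $C^1$ function.) A nonnegative function is integrable near $0$ if it is integrable on $(0,\tau']$ for some $\tau'>0$. $\psi$ is strictly decreasing; $\psi(0):=+\infty$, $\psi^{-1}(+\infty)=0$, and $\psi^{-1}$ is the inverse of $\psi$, defined on $(\lim_{t\to\infty}\psi(t),+\infty]$. *)

theory Defs
  imports "HOL-Probability.Probability"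
begin

section \<open>O-minimal structures over the real field\<close>

text \<open>A point of the n-dimensional real space is a list of length \<open>n\<close>.\<close>

inductive polynomial_map :: "nat \<Rightarrow> (real list \<Rightarrow> real) \<Rightarrow> bool" for n where
  const: "polynomial_map n (\<lambda>_. c)"
| coord: "i < n \<Longrightarrow> polynomial_map n (\<lambda>xs. xs ! i)"
| add: "polynomial_map n p \<Longrightarrow> polynomial_map n q \<Longrightarrow> polynomial_map n (\<lambda>xs. p xs + q xs)"
| mult: "polynomial_map n p \<Longrightarrow> polynomial_map n q \<Longrightarrow> polynomial_map n (\<lambda>xs. p xs * q xs)"

text \<open>\<open>Def n\<close> is the collection of definable subsets of the n-dimensional space. In the last
  axiom, \<open>is_interval\<close> covers singletons and all bounded and unbounded intervals.\<close>

locale o_minimal_structure =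
  fixes Def :: "nat \<Rightarrow> real list set set"
  assumes dim: "A \<in> Def n \<Longrightarrow> A \<subseteq> {xs. length xs = n}"
    and compl: "A \<in> Def n \<Longrightarrow> {xs. length xs = n} - A \<in> Def n"
    and union: "A \<in> Def n \<Longrightarrow> B \<in> Def n \<Longrightarrow> A \<union> B \<in> Def n"
    and times_right: "A \<in> Def n \<Longrightarrow> {xs @ [t] |xs t. xs \<in> A} \<in> Def (Suc n)"
    and times_left: "A \<in> Def n \<Longrightarrow> {t # xs |xs t. xs \<in> A} \<in> Def (Suc n)"
    and projection: "A \<in> Def (Suc n) \<Longrightarrow> butlast ` A \<in> Def n"
    and algebraic: "polynomial_map n p \<Longrightarrow> {xs. length xs = n \<and> p xs = 0} \<in> Def n"
    and o_minimal:
      "Def 1 = {(\<lambda>t. [t]) ` \<Union>\<J> |\<J>. finite \<J> \<and> (\<forall>J\<in>\<J>. is_interval (J :: real set))}"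

text \<open>A function is definable if its graph is. The list \<open>js\<close> enumerates the coordinates; since
  definable sets are stable under permutation of coordinates, its choice is immaterial.\<close>

definition definable_fun ::
    "(nat \<Rightarrow> real list set set) \<Rightarrow> (real ^ 'n \<Rightarrow> real) \<Rightarrow> bool" where
  "definable_fun Def f \<longleftrightarrow>
    (\<exists>js. distinct js \<and> set js = (UNIV :: 'n::finite set) \<and>
      range (\<lambda>x. map (\<lambda>j. x $ j) js @ [f x]) \<in> Def (CARD('n) + 1))"

section \<open>Gradients and regularity\<close>

definition grad :: "('a::real_inner \<Rightarrow> real) \<Rightarrow> 'a \<Rightarrow> 'a" where
  "grad f x = (THE g. GDERIV f x :> g)"

definition C1_fun :: "('a::euclidean_space \<Rightarrow> real) \<Rightarrow> bool" where
  "C1_fun f \<longleftrightarrow> (\<forall>x. f differentiable (at x)) \<and> continuous_on UNIV (grad f)"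

definition locally_lipschitz :: "('a::metric_space \<Rightarrow> 'b::metric_space) \<Rightarrow> bool" where
  "locally_lipschitz f \<longleftrightarrow> (\<forall>x. \<exists>r>0. \<exists>L. L-lipschitz_on (ball x r) f)"

definition coercive :: "('a::real_normed_vector \<Rightarrow> real) \<Rightarrow> bool" where
  "coercive f \<longleftrightarrow> filterlim f at_top at_infinity"

section \<open>Block structure\<close>

text \<open>The product of the block spaces is \<open>real ^ 'n\<close>, where \<open>b j\<close> is the index of the block that
  contains the coordinate \<open>j\<close>. The \<open>i\<close>-th block space is identified, through its canonical
  embedding, with the subspace of vectors supported on the block; the embedding is then the
  inclusion, and its transpose is \<open>block_proj b i\<close>.\<close>

definition block_space :: "('n::finite \<Rightarrow> nat) \<Rightarrow> nat \<Rightarrow> (real ^ 'n) set" where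
  "block_space b i = {u. \<forall>j. b j \<noteq> i \<longrightarrow> u $ j = 0}"

definition block_proj :: "('n::finite \<Rightarrow> nat) \<Rightarrow> nat \<Rightarrow> real ^ 'n \<Rightarrow> real ^ 'n" where
  "block_proj b i x = (\<chi> j. if b j = i then x $ j else 0)"

definition block_replace ::
    "('n::finite \<Rightarrow> nat) \<Rightarrow> nat \<Rightarrow> real ^ 'n \<Rightarrow> real ^ 'n \<Rightarrow> real ^ 'n" where
  "block_replace b i x u = (\<chi> j. if b j = i then u $ j else x $ j)"

definition block_grad ::
    "('n::finite \<Rightarrow> nat) \<Rightarrow> nat \<Rightarrow> (real ^ 'n \<Rightarrow> real) \<Rightarrow> real ^ 'n \<Rightarrow> real ^ 'n" where
  "block_grad b i G x = block_proj b i (grad G x)"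

definition blockwise_regular ::
    "('n::finite \<Rightarrow> nat) \<Rightarrow> nat \<Rightarrow> (real ^ 'n \<Rightarrow> real) \<Rightarrow> (real ^ 'n \<Rightarrow> real) \<Rightarrow> (real ^ 'n) set \<Rightarrow>
     (nat \<Rightarrow> real) \<Rightarrow> (nat \<Rightarrow> real) \<Rightarrow> (nat \<Rightarrow> real) \<Rightarrow> bool" where
  "blockwise_regular b m F R S LF LR vrho \<longleftrightarrow>
    (\<forall>i\<in>{1..m}.
      LF i > 0 \<and> LR i > 0 \<and> vrho i \<ge> 0 \<and>
      (\<forall>x. \<forall>u\<in>block_space b i.
        F (x + u) \<le> F x + inner (block_grad b i F x) u + LF i / 2 * (norm u)\<^sup>2) \<and>
      (\<forall>x. convex_on (block_space b i)
        (\<lambda>u. R (block_replace b i x u) + vrho i / 2 * (norm u)\<^sup>2)) \<and>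
      (\<forall>x. \<forall>u\<in>block_space b i. x \<in> S \<longrightarrow> x + u \<in> S \<longrightarrow>
        norm (block_grad b i R (x + u) - block_grad b i R x) \<le> LR i * norm u))"

section \<open>The block proximal-gradient map\<close>

text \<open>\<open>Lh\<close> is the constant of the quadratic term. Where the minimizer is not unique,
  \<open>arg_min_on\<close> picks an unspecified element.\<close>

definition block_prox ::
    "('n::finite \<Rightarrow> nat) \<Rightarrow> (real ^ 'n \<Rightarrow> real) \<Rightarrow> (real ^ 'n \<Rightarrow> real) \<Rightarrow> (nat \<Rightarrow> real) \<Rightarrow>
     nat \<Rightarrow> real ^ 'n \<Rightarrow> real \<Rightarrow> real ^ 'n" where
  "block_prox b F R Lh i x a =
    arg_min_on
      (\<lambda>u. R (x + (u - block_proj b i x)) + inner (block_grad b i F x) (u - block_proj b i x)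
           + Lh i / (2 * a) * (norm (u - block_proj b i x))\<^sup>2)
      (block_space b i)"

definition block_prox_map ::
    "('n::finite \<Rightarrow> nat) \<Rightarrow> (real ^ 'n \<Rightarrow> real) \<Rightarrow> (real ^ 'n \<Rightarrow> real) \<Rightarrow> (nat \<Rightarrow> real) \<Rightarrow>
     nat \<Rightarrow> real ^ 'n \<Rightarrow> real \<Rightarrow> real ^ 'n" where
  "block_prox_map b F R Lh i x a = block_replace b i x (block_prox b F R Lh i x a)"

section \<open>Desingularization\<close>

definition global_KL_desingularization ::
    "('a::euclidean_space \<Rightarrow> real) \<Rightarrow> (real \<Rightarrow> real) \<Rightarrow> bool" where
  "global_KL_desingularization H vphi \<longleftrightarrow>
    continuous_on {0..} vphi \<and> concave_on {0..} vphi \<and> (\<forall>t\<ge>0. vphi t \<ge> 0) \<and> vphi 0 = 0 \<and>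
    (\<forall>t>0. vphi differentiable (at t) \<and> deriv vphi t > 0) \<and>
    continuous_on {0<..} (deriv vphi) \<and>
    (\<forall>x. \<not> is_arg_min H (\<lambda>_. True) x \<longrightarrow>
      deriv vphi (H x - (INF y. H y)) * norm (grad H x) \<ge> 1)"

definition KL_phi :: "(real \<Rightarrow> real) \<Rightarrow> real \<Rightarrow> real" where
  "KL_phi vphi t = (if t = 0 then 0 else 1 / (deriv vphi t)\<^sup>2)"

text \<open>The interval integral is oriented, so \<open>KL_psi vphi t0 t\<close> is negative for \<open>t > t0\<close>.\<close>

definition KL_psi :: "(real \<Rightarrow> real) \<Rightarrow> real \<Rightarrow> real \<Rightarrow> ereal" where
  "KL_psi vphi t0 t = (if t = 0 then \<infinity> else ereal (LBINT s=t..t0. (deriv vphi s)\<^sup>2))"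

definition KL_psi_inv :: "(real \<Rightarrow> real) \<Rightarrow> real \<Rightarrow> ereal \<Rightarrow> real" where
  "KL_psi_inv vphi t0 = inv_into {0..} (KL_psi vphi t0)"

definition integrable_near_0 :: "(real \<Rightarrow> real) \<Rightarrow> bool" where
  "integrable_near_0 f \<longleftrightarrow> (\<exists>\<tau>>0. set_integrable lborel {0<..\<tau>} f)"

end

theory Submission
  imports Defs
begin

text \<open>Along the block step the gap \<open>D = H - H*\<close> drops by at least \<open>c1 \<alpha> v \<parallel>\<nabla>H\<parallel>\<^sup>2\<close>, where \<open>v\<close> is the
  weighted share of the sampled block in the squared gradient norm. As \<open>\<psi>' = - \<phi>'\<^sup>2\<close> is monotone and
  \<open>\<phi>'(D) \<parallel>\<nabla>H\<parallel> \<ge> 1\<close>, each step raises \<open>\<psi>(D)\<close> by at least \<open>c1 \<alpha> v\<close>. The conditional mean of \<open>v\<close> is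
  at least \<open>c2\<close> and \<open>v\<close> takes values in \<open>[0, c3]\<close>, so a Chernoff bound controls the event that the
  accumulated sum of \<open>\<alpha> v\<close> is below \<open>c2 A / 2\<close>; on it \<open>D\<close> is bounded by its initial value. The same
  bound and Borel--Cantelli give the almost sure rate. Concavity of \<open>\<phi>\<close> makes \<open>E \<phi>(D)\<close> decrease by
  at least \<open>c1 c2 \<alpha> E \<parallel>\<nabla>H\<parallel>\<close> per step, which bounds the expected length of the trajectory;
  almost surely, the length of a step is bounded through the geometric mean of the decrements of
  \<open>\<phi>\<close> along the trajectory and along the deterministic rate, and both decrements telescope.
  Finally, \<open>\<phi>'\<^sup>2\<close> is not integrable near zero because a locally Lipschitz gradient gives
  \<open>\<parallel>\<nabla>H\<parallel>\<^sup>2 \<le> L D\<close> near a boundary point of the set of minimizers.\<close>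

section \<open>Gradients\<close>

lemma GDERIV_unique:
  assumes "GDERIV f x :> g" "GDERIV f x :> g'"
  shows "g = g'"
proof -
  have "(\<lambda>h. inner h g) = (\<lambda>h. inner h g')"
    using assms has_derivative_unique unfolding gderiv_def by blast
  then show ?thesis
    by (metis vector_eq_ldot)
qed

lemma grad_eqI: "GDERIV f x :> g \<Longrightarrow> grad f x = g"
  unfolding grad_def using GDERIV_unique by blast

text \<open>The values of the derivative on the orthonormal basis are the coordinates of a gradient;
  uniqueness then makes the definite description in \<open>grad\<close> denote it.\<close>

lemma GDERIV_grad:
  fixes f :: "'a::euclidean_space \<Rightarrow> real"
  assumes "f differentiable (at x)"
  shows "GDERIV f x :> grad f x"
proof -
  obtain f' where f': "(f has_derivative f') (at x)"
    using assms by (auto simp: differentiable_def)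
  then have lin: "linear f'"
    by (rule has_derivative_linear)
  have "f' h = inner h (\<Sum>e\<in>Basis. f' e *\<^sub>R e)" for h
  proof -
    have "f' h = f' (\<Sum>e\<in>Basis. inner h e *\<^sub>R e)"
      by (simp add: euclidean_representation)
    also have "\<dots> = (\<Sum>e\<in>Basis. inner h e * f' e)"
      using lin by (simp add: linear_sum linear_cmul)
    also have "\<dots> = inner h (\<Sum>e\<in>Basis. f' e *\<^sub>R e)"
      by (simp add: inner_sum_right mult.commute)
    finally show ?thesis .
  qed
  then have "f' = (\<lambda>h. inner h (\<Sum>e\<in>Basis. f' e *\<^sub>R e))"
    by (rule ext)
  then have "GDERIV f x :> (\<Sum>e\<in>Basis. f' e *\<^sub>R e)"
    unfolding gderiv_def using f' by simp
  then show ?thesis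
    using grad_eqI by fastforce
qed

lemma DERIV_along_line:
  assumes "GDERIV f (x + t *\<^sub>R v) :> g"
  shows "((\<lambda>s. f (x + s *\<^sub>R v)) has_real_derivative inner v g) (at t)"
proof -
  have "((\<lambda>s. x + s *\<^sub>R v) has_derivative (\<lambda>s. s *\<^sub>R v)) (at t)"
    by (auto intro!: derivative_eq_intros)
  moreover have "(f has_derivative (\<lambda>h. inner h g)) (at (x + t *\<^sub>R v))"
    using assms by (simp add: gderiv_def)
  ultimately have "((\<lambda>s. f (x + s *\<^sub>R v)) has_derivative (\<lambda>s. inner (s *\<^sub>R v) g)) (at t)"
    by (rule has_derivative_compose)
  then show ?thesis
    by (simp add: has_field_derivative_def mult_commute_abs)
qed

lemma GDERIV_isCont: "GDERIV f x :> g \<Longrightarrow> isCont f x"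
  unfolding gderiv_def by (rule has_derivative_continuous)

text \<open>Minimality is asked for only along the line in direction \<open>v\<close>, so the same
  fact serves minimizers over a block subspace.\<close>

lemma inner_GDERIV_min_eq_0:
  assumes "GDERIV f x :> g" "\<And>t. f x \<le> f (x + t *\<^sub>R v)"
  shows "inner v g = 0"
proof -
  have "((\<lambda>s. f (x + s *\<^sub>R v)) has_real_derivative inner v g) (at 0)"
    by (rule DERIV_along_line) (use assms in simp)
  then show ?thesis
    by (rule DERIV_local_min[where d = 1]) (use assms in auto)
qed

lemma GDERIV_min_eq_0:
  assumes "GDERIV f x :> g" "\<And>y. f x \<le> f y"
  shows "g = 0"
proof -
  have "inner g g = 0"
    by (rule inner_GDERIV_min_eq_0[OF assms(1)]) (rule assms(2))
  then show ?thesis by simp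
qed

section \<open>Coercive functions and gradients near a minimizer\<close>

lemma coercive_bounded_sublevel:
  assumes "coercive f"
  shows "bounded {x. f x \<le> c}"
proof -
  have "\<forall>\<^sub>F x in at_infinity. c < f x"
    using assms unfolding coercive_def by (simp add: filterlim_at_top_dense)
  then obtain B where B: "\<And>x. B \<le> norm x \<Longrightarrow> c < f x"
    unfolding eventually_at_infinity by blast
  show ?thesis
    by (rule boundedI[of _ B]) (use B in \<open>force simp: not_le[symmetric]\<close>)
qed

lemma coercive_attains_min:
  fixes f :: "'a::euclidean_space \<Rightarrow> real"
  assumes "coercive f" and cont: "continuous_on UNIV f"
  obtains z where "\<And>x. f z \<le> f x"
proof -
  let ?K = "{x. f x \<le> f 0}"
  have "closed ?K"
    by (rule closed_Collect_le) (use cont in auto)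
  then have "compact ?K"
    using coercive_bounded_sublevel[OF assms(1)] by (simp add: compact_eq_bounded_closed)
  moreover have "?K \<noteq> {}" by blast
  ultimately obtain z where z: "z \<in> ?K" "\<And>x. x \<in> ?K \<Longrightarrow> f z \<le> f x"
    using continuous_attains_inf[of ?K f] continuous_on_subset[OF cont] by blast
  have "f z \<le> f x" for x
  proof (cases "x \<in> ?K")
    case False
    then show ?thesis using z(1) by simp
  qed (rule z(2))
  then show ?thesis by (rule that)
qed

text \<open>A gradient step of size \<open>1 / (2 * K)\<close> lowers \<open>f\<close> by at least
  \<open>(norm (G x))\<^sup>2 / (4 * K)\<close>, and no step can lower it by more than
  \<open>f x - f z\<close>.\<close>

lemma gradient_squared_le:
  fixes f :: "'a::euclidean_space \<Rightarrow> real"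
  assumes G: "\<And>x. GDERIV f x :> G x" and lip: "locally_lipschitz G" and z: "\<And>x. f z \<le> f x"
  obtains r L where "r > 0" "L > 0" "\<And>x. x \<in> ball z r \<Longrightarrow> (norm (G x))\<^sup>2 \<le> L * (f x - f z)"
proof -
  obtain r L where r: "r > 0" and L: "L-lipschitz_on (ball z r) G"
    using lip unfolding locally_lipschitz_def by blast
  define K where "K = max L 1"
  have K: "K > 0" by (simp add: K_def)
  have lipK: "norm (G x - G y) \<le> K * norm (x - y)" if "x \<in> ball z r" "y \<in> ball z r" for x y
  proof -
    have "norm (G x - G y) \<le> L * norm (x - y)"
      using lipschitz_onD[OF L that] by (simp add: dist_norm)
    also have "\<dots> \<le> K * norm (x - y)"
      by (rule mult_right_mono) (auto simp: K_def)
    finally show ?thesis .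
  qed
  have Gz: "G z = 0"
    by (rule GDERIV_min_eq_0[OF G z])
  \<comment> \<open>On the half ball the gradient step is at most half as long as the distance to
    \<open>z\<close>, because \<open>G z = 0\<close>; the whole segment thus stays where
    \<open>G\<close> is Lipschitz.\<close>
  have "(norm (G x))\<^sup>2 \<le> 4 * K * (f x - f z)" if x: "x \<in> ball z (r / 2)" for x
  proof -
    define v where "v = - (1 / (2 * K)) *\<^sub>R G x"
    have xr: "dist z x < r / 2" "x \<in> ball z r"
      using x r by auto
    have "norm (G x) \<le> K * norm (x - z)"
      using lipK[of x z] Gz xr r by simp
    then have nv: "norm v \<le> norm (x - z) / 2"
      using K by (simp add: v_def field_simps)
    have seg: "x + t *\<^sub>R v \<in> ball z r" if "0 \<le> t" "t \<le> 1" for t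
    proof -
      have "norm (t *\<^sub>R v) \<le> norm v"
        using that by (simp add: mult_left_le_one_le)
      moreover have "dist z (x + t *\<^sub>R v) \<le> dist z x + norm (t *\<^sub>R v)"
        by (metis dist_triangle dist_add_cancel add.right_neutral dist_0_norm)
      ultimately show ?thesis
        using nv xr by (simp add: dist_norm norm_minus_commute)
    qed
    have "\<exists>t>0. t < 1 \<and> f (x + 1 *\<^sub>R v) - f (x + 0 *\<^sub>R v) = (1 - 0) * inner v (G (x + t *\<^sub>R v))"
      by (rule MVT2) (auto intro: DERIV_along_line G)
    then obtain t where t: "0 < t" "t < 1"
      and mv: "f (x + v) - f x = inner v (G (x + t *\<^sub>R v))" by auto
    have "norm (G (x + t *\<^sub>R v) - G x) \<le> K * norm (t *\<^sub>R v)"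
      using lipK[OF seg[of t] xr(2)] t by simp
    also have "\<dots> \<le> K * norm v"
      using t K by (simp add: mult_left_le_one_le)
    finally have "inner v (G (x + t *\<^sub>R v) - G x) \<le> norm v * (K * norm v)"
      by (meson norm_cauchy_schwarz mult_left_mono norm_ge_zero order_trans)
    also have "\<dots> = (norm (G x))\<^sup>2 / (4 * K)"
      using K by (simp add: v_def power2_eq_square field_simps)
    finally have "inner v (G (x + t *\<^sub>R v)) \<le> inner v (G x) + (norm (G x))\<^sup>2 / (4 * K)"
      by (simp add: inner_diff_right)
    also have "inner v (G x) = - (norm (G x))\<^sup>2 / (2 * K)"
      by (simp add: v_def power2_norm_eq_inner)
    finally have "f (x + v) - f x \<le> - (norm (G x))\<^sup>2 / (4 * K)"
      using mv K by (simp add: field_simps)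
    with z[of "x + v"] have "(norm (G x))\<^sup>2 / (4 * K) \<le> f x - f z"
      by simp
    then show ?thesis
      using K by (simp add: field_simps)
  qed
  then show ?thesis
    using that[of "r / 2" "4 * K"] r K by auto
qed

section \<open>Desingularizing functions\<close>

text \<open>The last assumption holds for every desingularizing function of a function with locally
  Lipschitz gradient; it makes \<open>(deriv \<phi>)\<^sup>2\<close> non-integrable near zero.\<close>

locale desingularizing =
  fixes \<phi> :: "real \<Rightarrow> real"
  assumes cont: "continuous_on {0..} \<phi>"
    and concave: "concave_on {0..} \<phi>"
    and zero: "\<phi> 0 = 0"
    and diff: "\<And>t. t > 0 \<Longrightarrow> \<phi> differentiable (at t)"
    and deriv_pos: "\<And>t. t > 0 \<Longrightarrow> deriv \<phi> t > 0"
    and cont_deriv: "continuous_on {0<..} (deriv \<phi>)"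
    and steep: "\<exists>L>0. \<exists>\<tau>>0. \<forall>t. 0 < t \<longrightarrow> t \<le> \<tau> \<longrightarrow> 1 \<le> L * t * (deriv \<phi> t)\<^sup>2"

text \<open>Every ball around a boundary point \<open>z\<close> of the set of minimizers contains
  some \<open>w\<close> with a larger value, so by connectedness all gaps up to
  \<open>H w - H z\<close> occur in the ball. At a point with gap \<open>t\<close> the KL inequality
  and \<open>gradient_squared_le\<close> combine to
  \<open>1 \<le> (deriv \<phi> t)\<^sup>2 * (L * t)\<close>.\<close>

lemma global_KL_imp_desingularizing:
  fixes H :: "'a::euclidean_space \<Rightarrow> real"
  assumes KL: "global_KL_desingularization H \<phi>" and G: "\<And>x. GDERIV H x :> grad H x"
    and lip: "locally_lipschitz (grad H)" and coer: "coercive H"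
  shows "desingularizing \<phi>"
proof -
  have contH: "continuous_on UNIV H"
    using G GDERIV_isCont continuous_at_imp_continuous_on by blast
  obtain z0 where z0: "\<And>x. H z0 \<le> H x"
    using coercive_attains_min[OF coer contH] by blast
  have inf: "(INF x. H x) = H z0"
    by (rule cInf_eq_minimum) (use z0 in auto)
  let ?Z = "{x. H x = H z0}"
  have "closed ?Z"
    by (rule closed_Collect_eq) (use contH in auto)
  have "bounded ?Z"
    by (rule bounded_subset[OF coercive_bounded_sublevel[OF coer, of "H z0"]]) auto
  then have "?Z \<noteq> UNIV"
    using not_bounded_UNIV by metis
  then have "frontier ?Z \<noteq> {}"
    by (intro frontier_not_empty) auto
  then obtain z where z: "z \<in> frontier ?Z" by blast
  with \<open>closed ?Z\<close> have Hz: "H z = H z0"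
    using frontier_subset_eq by blast
  have zmin: "\<And>x. H z \<le> H x"
    using z0 Hz by simp
  obtain r L where r: "r > 0" and L: "L > 0"
    and bound: "\<And>x. x \<in> ball z r \<Longrightarrow> (norm (grad H x))\<^sup>2 \<le> L * (H x - H z)"
    using gradient_squared_le[OF G lip zmin] by blast
  obtain w where w: "w \<in> ball z r" "H w \<noteq> H z0"
    using z r unfolding frontier_straddle by (auto simp: dist_commute)
  have "1 \<le> L * t * (deriv \<phi> t)\<^sup>2" if t: "0 < t" "t \<le> H w - H z" for t
  proof -
    have "connected (H ` ball z r)"
      by (rule connected_continuous_image) (use contH continuous_on_subset in blast, simp)
    moreover have "H z \<in> H ` ball z r" "H w \<in> H ` ball z r"
      using r w by auto
    ultimately have "{H z..H w} \<subseteq> H ` ball z r"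
      by (rule connected_contains_Icc)
    then obtain x where x: "x \<in> ball z r" "H x = H z + t"
      using t by (auto simp: subset_iff image_iff dest!: spec[of _ "H z + t"])
    have "\<not> is_arg_min H (\<lambda>_. True) x"
      using x t not_le[of "H x" "H z"] unfolding is_arg_min_def by (auto intro!: exI[of _ z])
    then have "deriv \<phi> (H x - (INF y. H y)) * norm (grad H x) \<ge> 1"
      using KL unfolding global_KL_desingularization_def by blast
    then have "1 \<le> (deriv \<phi> t * norm (grad H x))\<^sup>2"
      using x inf Hz by (simp add: power2_eq_square mult_ge1_I)
    also have "\<dots> \<le> (deriv \<phi> t)\<^sup>2 * (L * t)"
      using bound[OF x(1)] x(2) by (simp add: power_mult_distrib mult_left_mono)
    finally show ?thesis by (simp add: mult_ac)
  qed
  moreover have "H w - H z > 0"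
    using w z0[of w] Hz by simp
  ultimately have steep: "\<exists>L>0. \<exists>\<tau>>0. \<forall>t. 0 < t \<longrightarrow> t \<le> \<tau> \<longrightarrow> 1 \<le> L * t * (deriv \<phi> t)\<^sup>2"
    using L by blast
  show ?thesis
    by unfold_locales
      (use KL steep in \<open>auto simp: global_KL_desingularization_def\<close>)
qed


context desingularizing
begin

lemma DERIV: "0 < t \<Longrightarrow> (\<phi> has_real_derivative deriv \<phi> t) (at t)"
  using diff by (simp add: DERIV_deriv_iff_real_differentiable)

text \<open>The argument \<open>s\<close> may be \<open>0\<close>, where \<phi> need not have a
  derivative; this admits iterates that hit the set of minimizers exactly.\<close>

lemma tangent:
  assumes "0 < t" "0 \<le> s"
  shows "\<phi> s \<le> \<phi> t + deriv \<phi> t * (s - t)"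
proof -
  have "((\<lambda>u. - \<phi> u) has_real_derivative - deriv \<phi> t) (at t within {0..})"
    using DERIV[OF assms(1)] by (intro DERIV_minus) (rule has_field_derivative_at_within)
  then have "- \<phi> s - - \<phi> t \<ge> - deriv \<phi> t * (s - t)"
    using concave assms unfolding concave_on_def
    by (intro convex_on_imp_above_tangent[where A = "{0..}"]) auto
  then show ?thesis by simp
qed

text \<open>Adding the tangent inequalities at \<open>s\<close> and at \<open>t\<close> cancels the
  values of \<phi> and leaves a comparison of the slopes.\<close>

lemma deriv_antimono:
  assumes "0 < s" "s \<le> t"
  shows "deriv \<phi> t \<le> deriv \<phi> s"
proof (cases "s = t")
  case False
  have "0 \<le> (deriv \<phi> s - deriv \<phi> t) * (t - s)"
    using tangent[of s t] tangent[of t s] assms by (simp add: algebra_simps)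
  then show ?thesis
    using False assms by (simp add: zero_le_mult_iff)
qed simp

lemma mono:
  assumes "0 \<le> s" "s \<le> t"
  shows "\<phi> s \<le> \<phi> t"
proof (cases "t = 0")
  case False
  then have "deriv \<phi> t * (s - t) \<le> 0"
    using assms deriv_pos[of t] by (simp add: mult_le_0_iff)
  then show ?thesis
    using tangent[of t s] assms False by simp
qed (use assms in simp)

lemma nonneg: "0 \<le> t \<Longrightarrow> 0 \<le> \<phi> t"
  using mono[of 0 t] zero by simp

section \<open>The potential and its inverse\<close>

text \<open>The real-valued part of \<open>KL_psi\<close>, kept apart from the value infinity at
  zero so that calculus on the reals applies.\<close>

definition potential :: "real \<Rightarrow> real \<Rightarrow> real" where
  "potential t0 t = (LBINT s=t..t0. (deriv \<phi> s)\<^sup>2)"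

lemma KL_psi_eq: "KL_psi \<phi> t0 t = (if t = 0 then \<infinity> else ereal (potential t0 t))"
  by (simp add: KL_psi_def potential_def)

lemma potential_refl: "potential t0 t0 = 0"
  by (simp add: potential_def)

lemma potential_DERIV:
  assumes "0 < t0" "0 < t"
  shows "(potential t0 has_real_derivative - (deriv \<phi> t)\<^sup>2) (at t)"
proof -
  \<comment> \<open>A compact interval inside the positive half-line with both \<open>t\<close> and
    \<open>t0\<close> in its interior; the squared derivative is continuous on it.\<close>
  define a b where "a = min t t0 / 2" and "b = max t t0 + 1"
  have ab: "0 < a" "a < t" "a < t0" "t < b" "t0 < b"
    using assms by (auto simp: a_def b_def min_def max_def)
  have "continuous_on {a..b} (\<lambda>s. (deriv \<phi> s)\<^sup>2)"
    by (intro continuous_on_power continuous_on_subset[OF cont_deriv]) (use ab in auto)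
  then have "((\<lambda>u. LBINT s=t0..u. (deriv \<phi> s)\<^sup>2) has_vector_derivative (deriv \<phi> t)\<^sup>2)
      (at t within {a..b})"
    using ab by (intro interval_integral_FTC2) auto
  then have "((\<lambda>u. LBINT s=t0..u. (deriv \<phi> s)\<^sup>2) has_vector_derivative (deriv \<phi> t)\<^sup>2) (at t)"
    using ab by (simp add: at_within_Icc_at)
  then have "((\<lambda>u. - (LBINT s=t0..u. (deriv \<phi> s)\<^sup>2)) has_real_derivative - (deriv \<phi> t)\<^sup>2) (at t)"
    by (intro DERIV_minus) (simp add: has_real_derivative_iff_has_vector_derivative)
  moreover have "potential t0 = (\<lambda>u. - (LBINT s=t0..u. (deriv \<phi> s)\<^sup>2))"
    unfolding potential_def by (rule ext) (subst interval_integral_endpoints_reverse, simp)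
  ultimately show ?thesis by simp
qed

text \<open>The integrand decreases, so its value at the right end bounds it below. In the
  application \<open>t\<close> is the current gap and \<open>s\<close> the next one, so the slope is
  taken where the KL inequality is applied.\<close>

lemma potential_diff_ge:
  assumes "0 < t0" "0 < s" "s \<le> t"
  shows "(deriv \<phi> t)\<^sup>2 * (t - s) \<le> potential t0 s - potential t0 t"
proof -
  have "\<exists>y. ((\<lambda>u. potential t0 u + (deriv \<phi> t)\<^sup>2 * u) has_real_derivative y) (at x) \<and> y \<le> 0"
    if x: "s \<le> x" "x \<le> t" for x
  proof (intro exI conjI)
    show "((\<lambda>u. potential t0 u + (deriv \<phi> t)\<^sup>2 * u) has_real_derivative
        - (deriv \<phi> x)\<^sup>2 + (deriv \<phi> t)\<^sup>2) (at x)"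
      using assms x by (auto intro!: derivative_eq_intros potential_DERIV)
    show "- (deriv \<phi> x)\<^sup>2 + (deriv \<phi> t)\<^sup>2 \<le> 0"
      using deriv_antimono[of x t] deriv_pos[of t] assms x by (simp add: power_mono less_imp_le)
  qed
  from DERIV_nonpos_imp_nonincreasing[OF assms(3) this] show ?thesis
    by (simp add: algebra_simps)
qed

text \<open>One factor of the squared slope is bounded by its value at the left end and the other
  integrates to \<phi>. This converts an increase of the potential into a decrement of \<phi>, which
  telescopes.\<close>

lemma potential_diff_le:
  assumes "0 < t0" "0 < s" "s \<le> t"
  shows "potential t0 s - potential t0 t \<le> deriv \<phi> s * (\<phi> t - \<phi> s)"
proof -
  have "\<exists>y. ((\<lambda>u. potential t0 u + deriv \<phi> s * \<phi> u) has_real_derivative y) (at x) \<and> 0 \<le> y"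
    if x: "s \<le> x" "x \<le> t" for x
  proof (intro exI conjI)
    show "((\<lambda>u. potential t0 u + deriv \<phi> s * \<phi> u) has_real_derivative
        - (deriv \<phi> x)\<^sup>2 + deriv \<phi> s * deriv \<phi> x) (at x)"
      using assms x by (auto intro!: derivative_eq_intros potential_DERIV DERIV)
    show "0 \<le> - (deriv \<phi> x)\<^sup>2 + deriv \<phi> s * deriv \<phi> x"
      using deriv_antimono[of s x] deriv_pos[of x] assms x
      by (simp add: power2_eq_square mult_right_mono)
  qed
  from DERIV_nonneg_imp_nondecreasing[OF assms(3) this] show ?thesis
    by (simp add: algebra_simps)
qed

lemma potential_strict_decreasing:
  assumes "0 < t0" "0 < s" "s < t"
  shows "potential t0 t < potential t0 s"
proof -
  have "0 < (deriv \<phi> t)\<^sup>2 * (t - s)"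
    using assms deriv_pos[of t] by simp
  then show ?thesis
    using potential_diff_ge[of t0 s t] assms by simp
qed

lemma potential_le_iff:
  assumes "0 < t0" "0 < s" "0 < t"
  shows "potential t0 t \<le> potential t0 s \<longleftrightarrow> s \<le> t"
  using potential_strict_decreasing[of t0] assms by (metis linorder_le_less_linear order.asym order.order_iff_strict)

text \<open>By \<open>steep\<close> the squared slope is at least \<open>1 / (L * t)\<close> near
  zero, so the potential grows at least like \<open>- ln t / L\<close>; this is the monotonicity of
  \<open>?Q\<close>.\<close>

lemma potential_unbounded:
  assumes "0 < t0" "0 < s"
  obtains t where "0 < t" "t \<le> s" "C \<le> potential t0 t"
proof -
  obtain L \<tau> where L: "L > 0" and \<tau>: "\<tau> > 0"
    and st: "\<And>t. 0 < t \<Longrightarrow> t \<le> \<tau> \<Longrightarrow> 1 \<le> L * t * (deriv \<phi> t)\<^sup>2"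
    using steep by blast
  let ?Q = "\<lambda>t. potential t0 t + ln t / L"
  have Q: "?Q \<tau> \<le> ?Q t" if t: "0 < t" "t \<le> \<tau>" for t
  proof -
    have "\<exists>y. (?Q has_real_derivative y) (at x) \<and> y \<le> 0" if x: "t \<le> x" "x \<le> \<tau>" for x
    proof (intro exI conjI)
      show "(?Q has_real_derivative - (deriv \<phi> x)\<^sup>2 + 1 / x / L) (at x)"
        using assms x t L by (auto intro!: derivative_eq_intros potential_DERIV)
      show "- (deriv \<phi> x)\<^sup>2 + 1 / x / L \<le> 0"
        using st[of x] x t L by (simp add: field_simps)
    qed
    from DERIV_nonpos_imp_nonincreasing[OF t(2) this] show ?thesis .
  qed
  \<comment> \<open>The exponential solves \<open>ln t / L = ?Q \<tau> - C\<close>; the minimum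
    keeps \<open>t\<close> below \<open>s\<close> and within the range of
    \<open>steep\<close>.\<close>
  define t where "t = min (min \<tau> s) (exp (L * (?Q \<tau> - C)))"
  have t: "0 < t" "t \<le> \<tau>" "t \<le> s" "t \<le> exp (L * (?Q \<tau> - C))"
    using \<tau> assms by (auto simp: t_def)
  then have "ln t \<le> L * (?Q \<tau> - C)"
    by (metis exp_gt_zero ln_exp ln_le_cancel_iff)
  then have "ln t / L \<le> ?Q \<tau> - C"
    using L by (simp only: pos_divide_le_eq mult.commute[of L])
  with Q[OF t(1,2)] have "C \<le> potential t0 t" by simp
  with t that show ?thesis by blast
qed

text \<open>Zero is the only point at which \<open>KL_psi\<close> is infinite, so the choice made by
  \<open>inv_into\<close> is forced.\<close>

lemma KL_psi_inv_infinity: "KL_psi_inv \<phi> t0 \<infinity> = 0"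
proof -
  have "\<infinity> \<in> KL_psi \<phi> t0 ` {0..}"
    by (rule image_eqI[of _ _ 0]) (auto simp: KL_psi_eq)
  then have "KL_psi \<phi> t0 (KL_psi_inv \<phi> t0 \<infinity>) = \<infinity>"
    unfolding KL_psi_inv_def by (rule f_inv_into_f)
  then show ?thesis
    by (simp add: KL_psi_eq split: if_splits)
qed

text \<open>The point \<open>s\<close> certifies that \<open>y\<close> is attained: the potential is
  at most \<open>y\<close> there and reaches at least \<open>y\<close> closer to zero, so the
  intermediate value theorem applies and \<open>inv_into\<close> is a true inverse at
  \<open>y\<close>.\<close>

lemma KL_psi_inv:
  assumes t0: "0 < t0" and s: "0 < s" and y: "potential t0 s \<le> y"
  shows "0 < KL_psi_inv \<phi> t0 (ereal y)" "potential t0 (KL_psi_inv \<phi> t0 (ereal y)) = y"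
    "KL_psi_inv \<phi> t0 (ereal y) \<le> s"
proof -
  let ?Y = "KL_psi_inv \<phi> t0 (ereal y)"
  obtain r where r: "0 < r" "r \<le> s" "y \<le> potential t0 r"
    using potential_unbounded[OF t0 s] .
  have "\<exists>t. r \<le> t \<and> t \<le> s \<and> potential t0 t = y"
    by (rule IVT2) (use r y t0 in \<open>auto intro!: DERIV_isCont potential_DERIV\<close>)
  then obtain t where t: "r \<le> t" "t \<le> s" "potential t0 t = y" by blast
  then have "ereal y \<in> KL_psi \<phi> t0 ` {0..}"
    using r by (intro image_eqI[of _ _ t]) (auto simp: KL_psi_eq)
  then have "KL_psi \<phi> t0 ?Y = ereal y" "?Y \<in> {0..}"
    unfolding KL_psi_inv_def by (rule f_inv_into_f, rule inv_into_into)
  then show "0 < ?Y" and eq: "potential t0 ?Y = y"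
    by (auto simp: KL_psi_eq split: if_splits)
  then show "?Y \<le> s"
    using potential_le_iff[of t0 ?Y s] t0 s y by simp
qed

lemma le_KL_psi_inv:
  assumes "0 < t0" "0 < s" "potential t0 s \<le> y" "0 < t" "y \<le> potential t0 t"
  shows "t \<le> KL_psi_inv \<phi> t0 (ereal y)"
  using KL_psi_inv[OF assms(1-3)] potential_le_iff[of t0 t "KL_psi_inv \<phi> t0 (ereal y)"] assms
  by simp

section \<open>Integrability near zero\<close>

text \<open>For positive arguments the integrand is the slope of \<phi>. As \<phi> is continuous at
  \<open>0\<close>, the fundamental theorem for nonnegative integrands on open intervals gives
  integrability up to that end.\<close>

lemma integrable_deriv: "integrable_near_0 (\<lambda>t. 1 / sqrt (KL_phi \<phi> t))"
proof -
  have c: "isCont (deriv \<phi>) x" if "0 < x" for x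
    using cont_deriv that by (auto simp: continuous_on_eq_continuous_at)
  have "(\<phi> \<longlongrightarrow> 0) (at_right 0)"
    using cont zero unfolding continuous_on_def
    by (metis at_within_Ici_at_right atLeast_iff order_refl)
  then have A: "((\<phi> \<circ> real_of_ereal) \<longlongrightarrow> 0) (at_right (ereal 0))"
    by (simp add: ereal_tendsto_simps)
  have "(\<phi> \<longlongrightarrow> \<phi> 2) (at_left 2)"
    using DERIV[of 2] DERIV_isCont isCont_def tendsto_within_subset by (metis subset_UNIV zero_less_numeral)
  then have B: "((\<phi> \<circ> real_of_ereal) \<longlongrightarrow> \<phi> 2) (at_left (ereal 2))"
    by (simp add: ereal_tendsto_simps)
  \<comment> \<open>The open interval extends beyond \<open>1\<close> so as to contain the right end
    of \<open>{0<..1}\<close>.\<close>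
  have "set_integrable lborel (einterval (ereal 0) (ereal 2)) (deriv \<phi>)"
    by (rule interval_integral_FTC_nonneg[OF _ _ _ _ A B])
      (use c DERIV deriv_pos in \<open>auto intro!: AE_I2 less_imp_le\<close>)
  then have "set_integrable lborel {0<..1} (deriv \<phi>)"
    by (rule set_integrable_subset) auto
  moreover have "1 / sqrt (KL_phi \<phi> t) = deriv \<phi> t" if "t \<in> {0<..1}" for t
    using that deriv_pos[of t] by (simp add: KL_phi_def real_sqrt_divide)
  then have "set_integrable lborel {0<..1} (\<lambda>t. 1 / sqrt (KL_phi \<phi> t)) \<longleftrightarrow>
      set_integrable lborel {0<..1} (deriv \<phi>)"
    by (intro set_integrable_cong) auto
  ultimately show ?thesis
    unfolding integrable_near_0_def by (intro exI[of _ 1]) auto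
qed

text \<open>With \<tau> as base point, integrability would bound the potential by the integral over
  all of \<open>{0<..\<tau>}\<close>, against \<open>potential_unbounded\<close>.\<close>

lemma not_integrable_deriv_squared: "\<not> integrable_near_0 (\<lambda>t. 1 / KL_phi \<phi> t)"
proof
  assume "integrable_near_0 (\<lambda>t. 1 / KL_phi \<phi> t)"
  then obtain \<tau> where \<tau>: "0 < \<tau>" and "set_integrable lborel {0<..\<tau>} (\<lambda>t. 1 / KL_phi \<phi> t)"
    unfolding integrable_near_0_def by blast
  moreover have "set_integrable lborel {0<..\<tau>} (\<lambda>t. 1 / KL_phi \<phi> t) \<longleftrightarrow>
      set_integrable lborel {0<..\<tau>} (\<lambda>t. (deriv \<phi> t)\<^sup>2)"
    by (intro set_integrable_cong) (auto simp: KL_phi_def)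
  ultimately have int: "set_integrable lborel {0<..\<tau>} (\<lambda>t. (deriv \<phi> t)\<^sup>2)"
    by simp
  let ?C = "set_lebesgue_integral lborel {0<..\<tau>} (\<lambda>t. (deriv \<phi> t)\<^sup>2)"
  obtain t where t: "0 < t" "t \<le> \<tau>" "?C + 1 \<le> potential \<tau> t"
    using potential_unbounded[OF \<tau> \<tau>] .
  have "potential \<tau> t = set_lebesgue_integral lborel {t<..<\<tau>} (\<lambda>t. (deriv \<phi> t)\<^sup>2)"
    using t by (simp add: potential_def interval_lebesgue_integral_def)
  also have "\<dots> \<le> ?C"
    unfolding set_lebesgue_integral_def
  proof (rule integral_mono)
    have "set_integrable lborel {t<..<\<tau>} (\<lambda>t. (deriv \<phi> t)\<^sup>2)"
      by (rule set_integrable_subset[OF int]) (use t in auto)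
    then show "integrable lborel (\<lambda>s. indicat_real {t<..<\<tau>} s *\<^sub>R (deriv \<phi> s)\<^sup>2)"
      by (simp add: set_integrable_def)
    show "integrable lborel (\<lambda>s. indicat_real {0<..\<tau>} s *\<^sub>R (deriv \<phi> s)\<^sup>2)"
      using int by (simp add: set_integrable_def)
  qed (use t in \<open>auto split: split_indicator\<close>)
  finally show False
    using t by simp
qed

end

section \<open>One step of the block proximal-gradient map\<close>

lemma block_proj_in: "block_proj b i x \<in> block_space b i"
  by (simp add: block_proj_def block_space_def)

lemma block_proj_id: "u \<in> block_space b i \<Longrightarrow> block_proj b i u = u"
  by (auto simp: block_proj_def block_space_def vec_eq_iff)

lemma linear_block_proj: "linear (block_proj b i)"
  by (rule linearI) (auto simp: block_proj_def vec_eq_iff)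

lemma inner_block_proj: "u \<in> block_space b i \<Longrightarrow> inner u (block_proj b i x) = inner u x"
  unfolding inner_vec_def by (rule sum.cong) (auto simp: block_proj_def block_space_def)

lemma subspace_block_space: "subspace (block_space b i)"
  by (simp add: subspace_def block_space_def)

lemma norm_block_proj_le: "norm (block_proj b i x) \<le> norm x"
  by (rule norm_le_componentwise_cart) (simp add: block_proj_def)

text \<open>Every coordinate lies in exactly one block, so after exchanging the sums each square is
  counted once.\<close>

lemma sum_norm_block_proj:
  assumes "finite J" "range b \<subseteq> J"
  shows "(\<Sum>i\<in>J. (norm (block_proj b i x))\<^sup>2) = (norm x)\<^sup>2"
proof -
  have "(\<Sum>i\<in>J. (norm (block_proj b i x))\<^sup>2) = (\<Sum>i\<in>J. \<Sum>j\<in>UNIV. if b j = i then (x $ j)\<^sup>2 else 0)"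
    unfolding power2_norm_eq_inner inner_vec_def
    by (intro sum.cong) (auto simp: block_proj_def power2_eq_square)
  also have "\<dots> = (\<Sum>j\<in>UNIV. \<Sum>i\<in>J. if b j = i then (x $ j)\<^sup>2 else 0)"
    by (rule sum.swap)
  also have "\<dots> = (\<Sum>j\<in>UNIV. (x $ j)\<^sup>2)"
    using assms by (intro sum.cong) auto
  also have "\<dots> = (norm x)\<^sup>2"
    unfolding power2_norm_eq_inner inner_vec_def by (simp add: power2_eq_square)
  finally show ?thesis .
qed

section \<open>Deterministic estimates for one block step\<close>

text \<open>The constant \<mu> is \<open>c2\<close> without the sampling probability. The last bound
  on \<open>abar\<close> is the quotient condition with the division cleared, which covers
  \<open>vrho i = 0\<close> as well.\<close>

locale block_composite =
  fixes b :: "'n::finite \<Rightarrow> nat" and m :: nat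
    and F R H :: "real ^ 'n \<Rightarrow> real" and S :: "(real ^ 'n) set" and x0 :: "real ^ 'n"
    and LF LR vrho Lh :: "nat \<Rightarrow> real" and abar c1 \<mu> c3 :: real
  assumes blocks: "range b = {1..m}"
    and C1: "C1_fun F" "C1_fun R"
    and H_def: "H = (\<lambda>x. F x + R x)"
    and S_def: "S = {x. H x \<le> H x0}"
    and regular: "blockwise_regular b m F R S LF LR vrho"
    and Lh_def: "Lh = (\<lambda>i. LF i + vrho i)"
    and abar: "0 < abar" "abar < 2" "\<And>i. i \<in> {1..m} \<Longrightarrow> abar * vrho i < Lh i"
    and c1_def: "c1 = (1 - abar / 2) * (MIN i\<in>{1..m}. Lh i)"
    and \<mu>_def: "\<mu> = (MIN i\<in>{1..m}. 1 / (Lh i + abar * LR i)\<^sup>2)"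
    and c3_def: "c3 = (MAX i\<in>{1..m}. 1 / (Lh i - abar * vrho i)\<^sup>2)"
begin

lemma blocks_nonempty: "{1..m} \<noteq> {}"
  unfolding blocks[symmetric] by simp

lemma GDERIV_F: "GDERIV F x :> grad F x" and GDERIV_R: "GDERIV R x :> grad R x"
  using C1 by (auto simp: C1_fun_def intro: GDERIV_grad)

lemma GDERIV_H: "GDERIV H x :> grad F x + grad R x"
  unfolding H_def by (intro GDERIV_add GDERIV_F GDERIV_R)

lemma grad_H: "grad H x = grad F x + grad R x"
  by (rule grad_eqI[OF GDERIV_H])

lemma continuous_H: "continuous_on UNIV H" and continuous_R: "continuous_on UNIV R"
  using GDERIV_isCont[OF GDERIV_H] GDERIV_isCont[OF GDERIV_R]
  by (simp_all add: continuous_at_imp_continuous_on)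

lemma block_grad_H: "block_grad b i H x = block_grad b i F x + block_grad b i R x"
  by (simp add: block_grad_def grad_H linear_add[OF linear_block_proj])

lemma constants_pos:
  assumes "i \<in> {1..m}"
  shows "0 < LF i" "0 < LR i" "0 \<le> vrho i" "0 < Lh i"
  using regular assms by (auto simp: blockwise_regular_def Lh_def add_pos_nonneg)

lemma F_upper:
  assumes "i \<in> {1..m}" "d \<in> block_space b i"
  shows "F (x + d) \<le> F x + inner (block_grad b i F x) d + LF i / 2 * (norm d)\<^sup>2"
  using regular assms by (auto simp: blockwise_regular_def)

text \<open>Weak convexity on the segment from the current block to the displaced one bounds the
  difference quotients of \<open>R\<close> along \<open>d\<close>; the bound passes to the one-sided
  limit at \<open>0\<close>.\<close>

lemma R_lower:
  assumes i: "i \<in> {1..m}" and d: "d \<in> block_space b i"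
  shows "R x + inner d (grad R x) - vrho i / 2 * (norm d)\<^sup>2 \<le> R (x + d)"
proof -
  let ?p = "block_proj b i x"
  define r where "r = vrho i / 2"
  have cvx: "convex_on (block_space b i) (\<lambda>u. R (block_replace b i x u) + r * (norm u)\<^sup>2)"
    using regular i by (auto simp: blockwise_regular_def r_def)
  have repl: "block_replace b i x (?p + u) = x + u" if "u \<in> block_space b i" for u
    using that by (auto simp: block_replace_def block_proj_def block_space_def vec_eq_iff)
  have repl0: "block_replace b i x ?p = x"
    by (simp add: block_replace_def block_proj_def vec_eq_iff)
  have quot: "(R (x + t *\<^sub>R d) - R x) / t \<le> R (x + d) - R x + r * (1 - t) * (norm d)\<^sup>2"
    if t: "0 < t" "t < 1" for t
  proof -
    have pd: "?p + d \<in> block_space b i" "t *\<^sub>R d \<in> block_space b i"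
      by (auto intro: subspace_add subspace_scale subspace_block_space block_proj_in d)
    have eq: "(1 - t) *\<^sub>R ?p + t *\<^sub>R (?p + d) = ?p + t *\<^sub>R d"
      by (simp add: algebra_simps)
    have "R (x + t *\<^sub>R d) + r * (norm (?p + t *\<^sub>R d))\<^sup>2 \<le>
        (1 - t) * (R x + r * (norm ?p)\<^sup>2) + t * (R (x + d) + r * (norm (?p + d))\<^sup>2)"
      using convex_onD[OF cvx, of t ?p "?p + d"] t pd block_proj_in[of b i x] repl0 repl[OF d]
        repl[OF pd(2)]
      unfolding eq by simp
    \<comment> \<open>Translating a squared norm changes it by an affine function, so the terms in
      \<open>?p\<close> cancel and only \<open>r * t * (1 - t) * (norm d)\<^sup>2\<close> is
      left.\<close>
    moreover have "(norm (?p + t *\<^sub>R d))\<^sup>2 = (norm ?p)\<^sup>2 + 2 * t * inner ?p d + t\<^sup>2 * (norm d)\<^sup>2"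
      and "(norm (?p + d))\<^sup>2 = (norm ?p)\<^sup>2 + 2 * inner ?p d + (norm d)\<^sup>2"
      unfolding power2_norm_eq_inner
      by (simp_all add: inner_add_left inner_add_right inner_commute power2_eq_square[of t])
    ultimately have "R (x + t *\<^sub>R d) - R x \<le> (R (x + d) - R x + r * (1 - t) * (norm d)\<^sup>2) * t"
      by (simp add: algebra_simps power2_eq_square)
    then show ?thesis
      using t by (simp add: pos_divide_le_eq)
  qed
  have "((\<lambda>t. R (x + t *\<^sub>R d)) has_real_derivative inner d (grad R x)) (at 0)"
    by (rule DERIV_along_line) (simp add: GDERIV_R)
  then have "((\<lambda>t. (R (x + t *\<^sub>R d) - R x) / t) \<longlongrightarrow> inner d (grad R x)) (at_right 0)"
    unfolding has_field_derivative_iff by (auto intro: tendsto_mono[OF at_le])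
  moreover have "((\<lambda>t. R (x + d) - R x + r * (1 - t) * (norm d)\<^sup>2)
      \<longlongrightarrow> R (x + d) - R x + r * (1 - 0) * (norm d)\<^sup>2) (at_right 0)"
    by (intro tendsto_intros)
  moreover have "\<forall>\<^sub>F t in at_right 0. (R (x + t *\<^sub>R d) - R x) / t
      \<le> R (x + d) - R x + r * (1 - t) * (norm d)\<^sup>2"
    unfolding eventually_at_right_field using quot by (intro exI[of _ 1]) auto
  ultimately have "inner d (grad R x) \<le> R (x + d) - R x + r * (1 - 0) * (norm d)\<^sup>2"
    by (intro tendsto_le[OF trivial_limit_at_right_real])
  then show ?thesis by (simp add: r_def)
qed

text \<open>The objective of \<open>block_prox\<close> in terms of the displacement
  \<open>d = u - block_proj b i x\<close>.\<close>

definition model :: "nat \<Rightarrow> real ^ 'n \<Rightarrow> real \<Rightarrow> real ^ 'n \<Rightarrow> real" where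
  "model i x a d = R (x + d) + inner (block_grad b i F x) d + Lh i / (2 * a) * (norm d)\<^sup>2"

text \<open>By \<open>R_lower\<close> the model lies above a quadratic of curvature
  \<open>\<kappa> > 0\<close>. Outside the ball of radius \<open>2 * norm g / \<kappa>\<close> its
  quadratic term dominates the linear one, so the model is at least its value at \<open>0\<close>,
  and a minimizer on the compact part is global.\<close>

lemma model_attains_min:
  assumes i: "i \<in> {1..m}" and a: "0 < a" "a \<le> abar"
  obtains d where "d \<in> block_space b i" "\<And>v. v \<in> block_space b i \<Longrightarrow> model i x a d \<le> model i x a v"
proof -
  define g where "g = grad R x + block_grad b i F x"
  define \<kappa> where "\<kappa> = Lh i / a - vrho i"
  have "a * vrho i \<le> abar * vrho i"
    using constants_pos[OF i] a by (simp add: mult_right_mono)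
  then have \<kappa>: "\<kappa> > 0"
    using abar(3)[OF i] a by (simp add: \<kappa>_def field_simps)
  have low: "R x + inner d g + \<kappa> / 2 * (norm d)\<^sup>2 \<le> model i x a d" if "d \<in> block_space b i" for d
  proof -
    have "\<kappa> / 2 * (norm d)\<^sup>2 = Lh i / (2 * a) * (norm d)\<^sup>2 - vrho i / 2 * (norm d)\<^sup>2"
      using a by (simp add: \<kappa>_def field_simps)
    then show ?thesis
      using R_lower[OF i that, of x]
      unfolding model_def g_def inner_add_right inner_commute[of d "block_grad b i F x"] by linarith
  qed
  define K where "K = block_space b i \<inter> cball 0 (2 * norm g / \<kappa>)"
  have "compact K"
    unfolding K_def by (intro closed_Int_compact closed_subspace subspace_block_space compact_cball)
  moreover have zK: "0 \<in> K"
    using \<kappa> subspace_0[OF subspace_block_space] by (simp add: K_def)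
  moreover have "continuous_on K (model i x a)"
    unfolding model_def
    by (intro continuous_intros continuous_on_compose2[OF continuous_R]) auto
  ultimately obtain d where d: "d \<in> K" "\<And>v. v \<in> K \<Longrightarrow> model i x a d \<le> model i x a v"
    using continuous_attains_inf[of K "model i x a"] by blast
  have "model i x a d \<le> model i x a v" if v: "v \<in> block_space b i" for v
  proof (cases "v \<in> K")
    case False
    then have "2 * norm g / \<kappa> < norm v"
      using v by (simp add: K_def)
    then have "norm v * (2 * norm g) \<le> norm v * (\<kappa> * norm v)"
      using \<kappa> by (intro mult_left_mono) (auto simp: field_simps)
    then have "norm g * norm v \<le> \<kappa> / 2 * (norm v)\<^sup>2"
      by (simp add: power2_eq_square mult_ac)
    moreover have "- (norm g * norm v) \<le> inner v g"
      using Cauchy_Schwarz_ineq2[of v g] by (simp add: abs_le_iff mult.commute)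
    ultimately have "R x \<le> model i x a v"
      using low[OF v] by linarith
    moreover have "model i x a 0 = R x"
      by (simp add: model_def)
    ultimately show ?thesis
      using d(2)[OF zK] by simp
  qed (rule d(2))
  with d(1) that show ?thesis by (auto simp: K_def)
qed

text \<open>Existence of a minimizer makes \<open>arg_min_on\<close> return one; stationarity of the
  model along the block space is then the optimality condition.\<close>

lemma prox_step:
  assumes i: "i \<in> {1..m}" and a: "0 < a" "a \<le> abar"
  obtains d where "d \<in> block_space b i" "block_prox_map b F R Lh i x a = x + d"
    "block_grad b i R (x + d) + block_grad b i F x + (Lh i / a) *\<^sub>R d = 0"
proof -
  let ?V = "block_space b i" and ?p = "block_proj b i x"
  let ?f = "\<lambda>u. R (x + (u - ?p)) + inner (block_grad b i F x) (u - ?p)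
           + Lh i / (2 * a) * (norm (u - ?p))\<^sup>2"
  have f: "?f u = model i x a (u - ?p)" for u
    by (simp add: model_def)
  obtain d0 where d0: "d0 \<in> ?V" "\<And>v. v \<in> ?V \<Longrightarrow> model i x a d0 \<le> model i x a v"
    using model_attains_min[OF i a] by blast
  have minus_p: "u - ?p \<in> ?V" if "u \<in> ?V" for u
    by (intro subspace_diff subspace_block_space block_proj_in that)
  have "is_arg_min ?f (\<lambda>u. u \<in> ?V) (?p + d0)"
    unfolding is_arg_min_linorder f
    using d0 minus_p by (auto intro: subspace_add subspace_block_space block_proj_in)
  then have "is_arg_min ?f (\<lambda>u. u \<in> ?V) (block_prox b F R Lh i x a)"
    unfolding block_prox_def arg_min_on_def arg_min_def by (rule someI)
  then have u: "block_prox b F R Lh i x a \<in> ?V"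
    and umin: "\<And>v. v \<in> ?V \<Longrightarrow> ?f (block_prox b F R Lh i x a) \<le> ?f v"
    by (auto simp: is_arg_min_linorder)
  define d where "d = block_prox b F R Lh i x a - ?p"
  have d: "d \<in> ?V"
    unfolding d_def by (rule minus_p[OF u])
  have dmin: "model i x a d \<le> model i x a v" if "v \<in> ?V" for v
  proof -
    have "?f (block_prox b F R Lh i x a) \<le> ?f (?p + v)"
      by (intro umin subspace_add subspace_block_space block_proj_in that)
    then show ?thesis
      unfolding f d_def by simp
  qed
  have T: "block_prox_map b F R Lh i x a = x + d"
    using u by (auto simp: block_prox_map_def d_def block_replace_def block_proj_def
        block_space_def vec_eq_iff)
  define g where "g = grad R (x + d) + block_grad b i F x + (Lh i / a) *\<^sub>R d"
  have G: "GDERIV (model i x a) d :> g"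
  proof -
    have "((\<lambda>v. R (x + v)) has_derivative (\<lambda>h. inner h (grad R (x + d)))) (at d)"
    proof (rule has_derivative_compose[of "\<lambda>v. x + v" "\<lambda>h. h" d UNIV R])
      have "((\<lambda>v. x + v) has_derivative (\<lambda>h. 0 + h)) (at d)"
        by (intro has_derivative_add has_derivative_const has_derivative_ident)
      then show "((\<lambda>v. x + v) has_derivative (\<lambda>h. h)) (at d)" by simp
    qed (use GDERIV_R[of "x + d"] in \<open>simp add: gderiv_def\<close>)
    then have "(model i x a has_derivative (\<lambda>h. inner h (grad R (x + d))
        + inner (block_grad b i F x) h + Lh i / (2 * a) * (inner d h + inner h d))) (at d)"
      unfolding model_def power2_norm_eq_inner
      using a by (auto intro!: derivative_eq_intros simp: fun_eq_iff field_simps)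
    then show ?thesis
      by (simp add: gderiv_def g_def inner_add_right inner_commute[of d]
          inner_commute[of "block_grad b i F x"])
  qed
  have proj_g: "block_proj b i g = block_grad b i R (x + d) + block_grad b i F x + (Lh i / a) *\<^sub>R d"
    using d by (simp add: g_def linear_add[OF linear_block_proj] linear_cmul[OF linear_block_proj]
        block_grad_def block_proj_id block_proj_in)
  \<comment> \<open>Only directions inside the block are admissible. The projected gradient is one
    of them, and stationarity along it makes its own norm vanish.\<close>
  have "inner (block_proj b i g) g = 0"
    by (rule inner_GDERIV_min_eq_0[OF G])
      (intro dmin subspace_add subspace_scale subspace_block_space block_proj_in d)
  then have "inner (block_proj b i g) (block_proj b i g) = 0"
    by (simp add: inner_block_proj block_proj_in)
  then have "block_proj b i g = 0" by simp
  with d T proj_g that show ?thesis by metis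
qed

context
  fixes i :: nat and a :: real and x d :: "real ^ 'n"
  assumes i: "i \<in> {1..m}" and a: "0 < a" "a \<le> abar" and d: "d \<in> block_space b i"
    and opt: "block_grad b i R (x + d) + block_grad b i F x + (Lh i / a) *\<^sub>R d = 0"
begin

text \<open>The upper bound for \<open>F\<close> from \<open>x\<close> and the lower bound for
  \<open>R\<close> from \<open>x + d\<close> back to \<open>x\<close> add up to the curvature
  \<open>Lh i / 2\<close>; testing the optimality condition with \<open>d\<close> turns the
  first-order terms into \<open>- Lh i / a * (norm d)\<^sup>2\<close>.\<close>

lemma step_descent: "Lh i / a * (1 - a / 2) * (norm d)\<^sup>2 \<le> H x - H (x + d)"
proof -
  have "R x \<ge> R (x + d) - inner d (grad R (x + d)) - vrho i / 2 * (norm d)\<^sup>2"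
    using R_lower[OF i subspace_neg[OF subspace_block_space d], of "x + d"] by simp
  moreover have "inner d (grad R (x + d)) = inner d (block_grad b i R (x + d))"
    by (simp add: block_grad_def inner_block_proj d)
  moreover have "F (x + d) \<le> F x + inner d (block_grad b i F x) + LF i / 2 * (norm d)\<^sup>2"
    using F_upper[OF i d, of x] by (simp add: inner_commute)
  ultimately have "H (x + d) \<le> H x
      + (inner d (block_grad b i R (x + d)) + inner d (block_grad b i F x)) + Lh i / 2 * (norm d)\<^sup>2"
    by (simp add: H_def Lh_def distrib_right add_divide_distrib)
  moreover have "inner d (block_grad b i R (x + d)) + inner d (block_grad b i F x)
      + Lh i / a * (norm d)\<^sup>2 = 0"
    using arg_cong[OF opt, of "inner d"] by (simp add: inner_add_right power2_norm_eq_inner)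
  ultimately show ?thesis
    using a by (simp add: algebra_simps)
qed

text \<open>\<open>R_lower\<close> from \<open>x\<close> along \<open>d\<close> and from
  \<open>x + d\<close> along \<open>- d\<close> add up to weak monotonicity of the gradient of
  \<open>R\<close>. This replaces its value at the new point by that at the old one in the
  optimality condition tested with \<open>d\<close>.\<close>

lemma step_norm_le: "norm d \<le> a / (Lh i - abar * vrho i) * norm (block_grad b i H x)"
proof -
  have pos: "0 < Lh i - abar * vrho i" and vr: "0 \<le> vrho i"
    using abar(3)[OF i] constants_pos[OF i] by auto
  have "- vrho i * (norm d)\<^sup>2 \<le> inner d (grad R (x + d)) - inner d (grad R x)"
    using R_lower[OF i d, of x] R_lower[OF i subspace_neg[OF subspace_block_space d], of "x + d"]
    by simp
  also have "\<dots> = inner d (block_grad b i R (x + d)) - inner d (block_grad b i R x)"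
    by (simp add: block_grad_def inner_block_proj d)
  finally have "(Lh i / a - vrho i) * (norm d)\<^sup>2 \<le> - inner d (block_grad b i H x)"
    using arg_cong[OF opt, of "inner d"]
    by (simp add: inner_add_right power2_norm_eq_inner block_grad_H algebra_simps)
  also have "\<dots> \<le> norm d * norm (block_grad b i H x)"
    using Cauchy_Schwarz_ineq2[of d "block_grad b i H x"] by (simp add: abs_le_iff)
  finally have "(Lh i / a - vrho i) * norm d \<le> norm (block_grad b i H x)"
    by (cases "d = 0") (simp_all add: power2_eq_square mult.assoc[symmetric] mult.commute)
  then have "(Lh i - a * vrho i) * norm d \<le> a * norm (block_grad b i H x)"
    using a by (simp add: field_simps)
  moreover have "(Lh i - abar * vrho i) * norm d \<le> (Lh i - a * vrho i) * norm d"
    using a vr by (intro mult_right_mono) (auto simp: mult_right_mono)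
  ultimately show ?thesis
    using pos by (simp add: field_simps)
qed

text \<open>The Lipschitz bound for the gradient of \<open>R\<close> is available only inside
  \<open>S\<close>; \<open>step_descent\<close> keeps \<open>x + d\<close> there, and the optimality
  condition then compares the old gradient with \<open>d\<close>.\<close>

lemma norm_step_ge:
  assumes x: "x \<in> S"
  shows "norm (block_grad b i H x) \<le> (Lh i + abar * LR i) / a * norm d"
proof -
  have "0 \<le> Lh i / a * (1 - a / 2) * (norm d)\<^sup>2"
    using a abar constants_pos[OF i] by simp
  then have "x + d \<in> S"
    using step_descent x by (simp add: S_def)
  then have "norm (block_grad b i R (x + d) - block_grad b i R x) \<le> LR i * norm d"
    using regular i d x by (auto simp: blockwise_regular_def)
  moreover have "block_grad b i H x
      = - (block_grad b i R (x + d) - block_grad b i R x) - (Lh i / a) *\<^sub>R d"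
    using opt by (simp add: block_grad_H algebra_simps add_eq_0_iff)
  then have "norm (block_grad b i H x)
      \<le> norm (block_grad b i R (x + d) - block_grad b i R x) + Lh i / a * norm d"
    using norm_triangle_ineq4[of "- (block_grad b i R (x + d) - block_grad b i R x)" "(Lh i / a) *\<^sub>R d"]
      a constants_pos[OF i] by (simp add: norm_minus_commute)
  ultimately have "norm (block_grad b i H x) \<le> (LR i + Lh i / a) * norm d"
    by (simp add: algebra_simps)
  also have "\<dots> \<le> (Lh i + abar * LR i) / a * norm d"
    using a constants_pos[OF i] by (intro mult_right_mono) (auto simp: field_simps)
  finally show ?thesis .
qed

end

lemma c1_pos: "0 < c1"
  unfolding c1_def using abar blocks_nonempty constants_pos by (intro mult_pos_pos) auto

lemma c1_le: "i \<in> {1..m} \<Longrightarrow> c1 \<le> (1 - abar / 2) * Lh i"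
  unfolding c1_def using abar by (intro mult_left_mono) auto

lemma \<mu>_pos: "0 < \<mu>"
proof -
  have "0 < Lh i + abar * LR i" if "i \<in> {1..m}" for i
    using constants_pos[OF that] abar by (simp add: add_pos_pos)
  then show ?thesis
    unfolding \<mu>_def using blocks_nonempty by (subst Min_gr_iff) (auto, fastforce)
qed

lemma c3_ge: "i \<in> {1..m} \<Longrightarrow> 1 / (Lh i - abar * vrho i)\<^sup>2 \<le> c3"
  unfolding c3_def by (intro Max_ge) auto

lemma c3_pos: "0 < c3"
proof -
  obtain i where i: "i \<in> {1..m}" using blocks_nonempty by blast
  then have "0 < 1 / (Lh i - abar * vrho i)\<^sup>2"
    using abar(3)[OF i] by simp
  with c3_ge[OF i] show ?thesis by linarith
qed

lemma \<mu>_le: "i \<in> {1..m} \<Longrightarrow> \<mu> \<le> 1 / (Lh i + abar * LR i)\<^sup>2"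
  unfolding \<mu>_def by (intro Min_le) auto

text \<open>This lets \<open>c3\<close> serve as the upper bound of the sampled shares in the
  exponential moment estimate.\<close>

lemma weight_le_c3:
  assumes i: "i \<in> {1..m}"
  shows "1 / (Lh i + abar * LR i)\<^sup>2 \<le> c3"
proof -
  have "Lh i - abar * vrho i \<le> Lh i + abar * LR i" and "0 < Lh i - abar * vrho i"
    using constants_pos[OF i] abar(1) abar(3)[OF i]
      mult_nonneg_nonneg[of abar "vrho i"] mult_pos_pos[of abar "LR i"] by linarith+
  then have "1 / (Lh i + abar * LR i)\<^sup>2 \<le> 1 / (Lh i - abar * vrho i)\<^sup>2"
    by (intro divide_left_mono power_mono) auto
  with c3_ge[OF i] show ?thesis by linarith
qed

text \<open>The first bound measures almost sure step lengths by the decrease of \<open>H\<close>,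
  the second measures expected step lengths by the gradient, and the third drives the decay of the
  gap.\<close>

theorem prox_map_bounds:
  assumes i: "i \<in> {1..m}" and a: "0 < a" "a \<le> abar"
  defines "y \<equiv> \<lambda>x. block_prox_map b F R Lh i x a"
  shows "c1 / a * (norm (y x - x))\<^sup>2 \<le> H x - H (y x)"
    and "norm (y x - x) \<le> a * sqrt c3 * norm (grad H x)"
    and "x \<in> S \<Longrightarrow> c1 * a * ((norm (block_grad b i H x))\<^sup>2 / (Lh i + abar * LR i)\<^sup>2) \<le> H x - H (y x)"
proof -
  obtain d where d: "d \<in> block_space b i" and y: "y x = x + d"
    and opt: "block_grad b i R (x + d) + block_grad b i F x + (Lh i / a) *\<^sub>R d = 0"
    unfolding y_def using prox_step[OF i a] by blast
  note step = i a d opt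
  have pos: "0 < Lh i - abar * vrho i" "0 < Lh i + abar * LR i"
    using abar(1) abar(3)[OF i] constants_pos[OF i] by (auto intro: add_pos_pos)
  have "c1 \<le> (1 - abar / 2) * Lh i"
    by (rule c1_le[OF i])
  also have "\<dots> \<le> (1 - a / 2) * Lh i"
    using a constants_pos[OF i] by (intro mult_right_mono) auto
  finally have "c1 / a * (norm d)\<^sup>2 \<le> Lh i / a * (1 - a / 2) * (norm d)\<^sup>2"
    using a by (intro mult_right_mono) (auto simp: field_simps)
  also have "\<dots> \<le> H x - H (y x)"
    using step_descent[OF step] y by simp
  finally show desc: "c1 / a * (norm (y x - x))\<^sup>2 \<le> H x - H (y x)"
    using y by simp
  have "1 / (Lh i - abar * vrho i) \<le> sqrt c3"
    by (rule real_le_rsqrt) (use c3_ge[OF i] in \<open>simp add: power_divide\<close>)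
  then have "a * (1 / (Lh i - abar * vrho i)) * norm (block_grad b i H x) \<le> a * sqrt c3 * norm (grad H x)"
    using a pos c3_pos unfolding block_grad_def by (intro mult_mono mult_left_mono norm_block_proj_le) auto
  with step_norm_le[OF step] y show "norm (y x - x) \<le> a * sqrt c3 * norm (grad H x)"
    by simp
  assume x: "x \<in> S"
  have "a * norm (block_grad b i H x) \<le> (Lh i + abar * LR i) * norm d"
    using norm_step_ge[OF step x] a by (simp add: field_simps)
  then have "(a * norm (block_grad b i H x))\<^sup>2 \<le> ((Lh i + abar * LR i) * norm d)\<^sup>2"
    using a by (intro power_mono) auto
  then have "a * (a * ((norm (block_grad b i H x))\<^sup>2 / (Lh i + abar * LR i)\<^sup>2)) \<le> (norm d)\<^sup>2"
    using pos(2) by (simp add: power_mult_distrib pos_divide_le_eq mult.commute power2_eq_square[of a] mult.assoc)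
  then have "a * ((norm (block_grad b i H x))\<^sup>2 / (Lh i + abar * LR i)\<^sup>2) \<le> (norm d)\<^sup>2 / a"
    using a by (simp only: pos_le_divide_eq mult.commute)
  then have "c1 * (a * ((norm (block_grad b i H x))\<^sup>2 / (Lh i + abar * LR i)\<^sup>2)) \<le> c1 * ((norm d)\<^sup>2 / a)"
    using c1_pos by (intro mult_left_mono) auto
  with desc y show "c1 * a * ((norm (block_grad b i H x))\<^sup>2 / (Lh i + abar * LR i)\<^sup>2) \<le> H x - H (y x)"
    by (simp add: mult_ac)
qed

end

section \<open>Randomized descent\<close>

text \<open>This is the chord of the convex exponential between \<open>0\<close> and
  \<open>- ln 2\<close>, where its value is \<open>1 / 2\<close>.\<close>

lemma exp_minus_ln_2_le:
  fixes s :: real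
  assumes "0 \<le> s" "s \<le> 1"
  shows "exp (- (ln 2 * s)) \<le> 1 - s / 2"
proof -
  have "exp ((1 - s) *\<^sub>R 0 + s *\<^sub>R (- ln 2 :: real)) \<le> (1 - s) * exp 0 + s * exp (- ln 2)"
    using assms by (intro convex_onD[OF exp_convex]) auto
  then show ?thesis
    by (simp add: exp_minus mult.commute)
qed

text \<open>Exchanging series and integral shows that the sum has a finite integral, hence is finite
  almost everywhere. It serves both the Borel--Cantelli argument and the finite length of
  trajectories.\<close>

lemma AE_summable_of_bounded_integrals:
  fixes f :: "nat \<Rightarrow> 'a \<Rightarrow> real"
  assumes int: "\<And>n. integrable M (f n)" and nonneg: "\<And>n x. x \<in> space M \<Longrightarrow> 0 \<le> f n x"
    and bound: "\<And>N. (\<Sum>n<N. \<integral>x. f n x \<partial>M) \<le> B"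
  shows "AE x in M. summable (\<lambda>n. f n x)"
proof -
  have meas [measurable]: "f n \<in> borel_measurable M" for n
    using int by (rule borel_measurable_integrable)
  have eq: "(\<integral>\<^sup>+x. ennreal (f n x) \<partial>M) = ennreal (\<integral>x. f n x \<partial>M)" for n
    by (rule nn_integral_eq_integral[OF int]) (simp add: nonneg)
  have nn: "0 \<le> (\<integral>x. f n x \<partial>M)" for n
    by (rule integral_nonneg_AE) (simp add: nonneg)
  have "(\<Sum>n. ennreal (\<integral>x. f n x \<partial>M)) \<le> ennreal B"
  proof (rule suminf_le_const)
    fix N
    have "(\<Sum>n<N. ennreal (\<integral>x. f n x \<partial>M)) = ennreal (\<Sum>n<N. \<integral>x. f n x \<partial>M)"
      by (rule sum_ennreal) (rule nn)
    also have "\<dots> \<le> ennreal B"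
      by (rule ennreal_leI[OF bound])
    finally show "(\<Sum>n<N. ennreal (\<integral>x. f n x \<partial>M)) \<le> ennreal B" .
  qed simp
  then have "(\<integral>\<^sup>+x. (\<Sum>n. ennreal (f n x)) \<partial>M) \<le> ennreal B"
    by (subst nn_integral_suminf) (auto simp: eq)
  then have "(\<integral>\<^sup>+x. (\<Sum>n. ennreal (f n x)) \<partial>M) \<noteq> \<infinity>"
    by (metis ennreal_less_top infinity_ennreal_def leD)
  then have "AE x in M. (\<Sum>n. ennreal (f n x)) \<noteq> \<infinity>"
    by (intro nn_integral_PInf_AE) auto
  then show ?thesis
    using AE_space by eventually_elim (rule summable_suminf_not_top, auto simp: nonneg)
qed

lemma (in finite_measure) simple_integrable:
  fixes f :: "'a \<Rightarrow> 'b::{banach, second_countable_topology}"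
  assumes "simple_function M f"
  shows "integrable M f"
proof (rule integrable_const_bound)
  have fin: "finite (norm ` f ` space M)"
    using simple_functionD(1)[OF assms] by simp
  show "AE x in M. norm (f x) \<le> Max (norm ` f ` space M)"
    by (rule AE_I2) (use fin in auto)
  show "f \<in> borel_measurable M"
    using assms by (rule borel_measurable_simple_function)
qed

text \<open>The value infinity marks the points that never settle, so the last property holds at
  every point and only finiteness is left as an almost sure claim.\<close>

lemma first_settling_time:
  assumes [measurable]: "\<And>k. Measurable.pred M (Q k)"
  obtains K :: "'a \<Rightarrow> enat" where "K \<in> M \<rightarrow>\<^sub>M count_space UNIV"
    "\<And>x. (\<exists>N. \<forall>k\<ge>N. Q k x) \<Longrightarrow> K x < \<infinity>"
    "\<And>x k. K x \<le> enat k \<Longrightarrow> Q k x"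
proof
  let ?K = "\<lambda>x. if \<exists>N. \<forall>k\<ge>N. Q k x then enat (LEAST N. \<forall>k\<ge>N. Q k x) else \<infinity>"
  show "?K \<in> M \<rightarrow>\<^sub>M count_space UNIV"
    by measurable
  show "?K x < \<infinity>" if "\<exists>N. \<forall>k\<ge>N. Q k x" for x
    using that by simp
  show "Q k x" if "?K x \<le> enat k" for x k
  proof -
    have ex: "\<exists>N. \<forall>k\<ge>N. Q k x" and le: "(LEAST N. \<forall>k\<ge>N. Q k x) \<le> k"
      using that by (auto split: if_splits)
    show ?thesis
      using LeastI_ex[OF ex] le by blast
  qed
qed

text \<open>\<open>D\<close> is the objective gap and \<open>G\<close> the norm of the gradient; \<open>v i x\<close> is the
  (normalized) share of block \<open>i\<close> in the squared gradient norm.\<close>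

locale randomized_descent = prob_space M + kl: desingularizing \<phi>
  for M :: "'w measure" and \<phi> :: "real \<Rightarrow> real" +
  fixes \<F> :: "nat \<Rightarrow> 'w measure" and m :: nat and \<rho> :: real and I :: "nat \<Rightarrow> 'w \<Rightarrow> nat"
    and X :: "nat \<Rightarrow> 'w \<Rightarrow> 'a::euclidean_space" and T :: "nat \<Rightarrow> nat \<Rightarrow> 'a \<Rightarrow> 'a" and x0 :: 'a
    and D G :: "'a \<Rightarrow> real" and v :: "nat \<Rightarrow> 'a \<Rightarrow> real"
    and \<alpha> A :: "nat \<Rightarrow> real" and abar c1 c2 c3 \<mu> t0 :: real
  assumes filtr: "filtration (space M) \<F>" and subalg: "\<And>k. subalgebra M (\<F> k)"
    and I_meas: "\<And>k. I k \<in> \<F> (Suc k) \<rightarrow>\<^sub>M count_space {1..m}"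
    and I_prob: "\<And>k i. i \<in> {1..m} \<Longrightarrow>
      AE \<omega> in M. real_cond_exp M (\<F> k) (indicat_real {\<omega> \<in> space M. I k \<omega> = i}) \<omega> \<ge> \<rho>"
    and X_0: "\<And>\<omega>. \<omega> \<in> space M \<Longrightarrow> X 0 \<omega> = x0"
    and X_Suc: "\<And>k \<omega>. \<omega> \<in> space M \<Longrightarrow> X (Suc k) \<omega> = T k (I k \<omega>) (X k \<omega>)"
    and step: "\<And>k. 0 < \<alpha> k" "\<And>k. \<alpha> k \<le> abar"
    and A_def: "A = (\<lambda>k. \<Sum>i<k. \<alpha> i)"
    and A_unbounded: "\<And>C. \<exists>k. C \<le> A k"
    and pos: "0 < \<rho>" "0 < \<mu>" "0 < c1" "0 < c3" "0 < t0"
    and c2_def: "c2 = \<rho> * \<mu>"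
    and D_nonneg: "\<And>x. 0 \<le> D x" and G_nonneg: "\<And>x. 0 \<le> G x"
    and D_cont: "continuous_on UNIV D"
    and bounded_sublevel: "bounded {x. D x \<le> D x0}"
    and KL: "\<And>x. 0 < D x \<Longrightarrow> 1 \<le> deriv \<phi> (D x) * G x"
    and stationary: "\<And>x. D x = 0 \<Longrightarrow> G x = 0"
    and v_bounds: "\<And>i x. i \<in> {1..m} \<Longrightarrow> 0 \<le> v i x" "\<And>i x. i \<in> {1..m} \<Longrightarrow> v i x \<le> c3"
    and v_sum: "\<And>x. \<mu> \<le> (\<Sum>i\<in>{1..m}. v i x)"
    and T_length: "\<And>k i x. i \<in> {1..m} \<Longrightarrow> c1 / \<alpha> k * (norm (T k i x - x))\<^sup>2 \<le> D x - D (T k i x)"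
    and T_length_le: "\<And>k i x. i \<in> {1..m} \<Longrightarrow> norm (T k i x - x) \<le> \<alpha> k * sqrt c3 * G x"
    and T_descent: "\<And>k i x. i \<in> {1..m} \<Longrightarrow> D x \<le> D x0 \<Longrightarrow>
      c1 * \<alpha> k * (v i x * (G x)\<^sup>2) \<le> D x - D (T k i x)"
begin

section \<open>Filtration, finitely valued iterates and sampling\<close>

lemma abar_pos: "0 < abar"
  using step(1)[of 0] step(2)[of 0] by linarith

lemma c2_pos: "0 < c2"
  using pos by (simp add: c2_def)

lemma A_mono: "i \<le> j \<Longrightarrow> A i \<le> A j"
  unfolding A_def using step(1) by (intro sum_mono2) (auto intro: less_imp_le)

lemma A_nonneg: "0 \<le> A k"
  unfolding A_def using step(1) by (intro sum_nonneg) (auto intro: less_imp_le)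

lemma A_Suc: "A (Suc k) = A k + \<alpha> k"
  by (simp add: A_def)

lemma space_\<F>: "space (\<F> k) = space M"
  using filtr by (rule filtration.space_F)

lemma I_in: "\<omega> \<in> space M \<Longrightarrow> I k \<omega> \<in> {1..m}"
  using measurable_space[OF I_meas[of k], of \<omega>] space_\<F> by simp

lemma I_simple: "simple_function (\<F> (Suc k)) (I k)"
  unfolding simple_function_eq_measurable
proof
  show "finite (I k ` space (\<F> (Suc k)))"
    by (rule finite_subset[of _ "{1..m}"]) (use I_in space_\<F> in auto)
  have "(\<lambda>x. x) \<in> count_space {1..m} \<rightarrow>\<^sub>M count_space (UNIV :: nat set)"
    by simp
  from measurable_compose[OF I_meas this] show "I k \<in> \<F> (Suc k) \<rightarrow>\<^sub>M count_space UNIV"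
    by simp
qed

lemma simple_function_mono: "simple_function (\<F> j) f \<Longrightarrow> j \<le> k \<Longrightarrow> simple_function (\<F> k) f"
  using filtration.sets_F_mono[OF filtr, of j k] space_\<F> unfolding simple_function_def by auto

lemma simple_function_M: "simple_function (\<F> k) f \<Longrightarrow> simple_function M f"
  using subalg[of k] unfolding simple_function_def subalgebra_def by auto

text \<open>The start is deterministic and each step chooses among finitely many blocks, so
  \<open>X k\<close> has finitely many values. Every function of \<open>X k\<close>, whatever its
  regularity, is therefore measurable and integrable.\<close>

lemma X_simple: "simple_function (\<F> k) (X k)"
proof (induction k)
  case 0
  have "simple_function (\<F> 0) (X 0) \<longleftrightarrow> simple_function (\<F> 0) (\<lambda>\<omega>. x0)"
    by (rule simple_function_cong) (simp add: X_0 space_\<F>)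
  then show ?case by simp
next
  case (Suc k)
  have "simple_function (\<F> (Suc k)) (\<lambda>\<omega>. T k (I k \<omega>) (X k \<omega>))"
    by (rule simple_function_compose2[where h = "T k", OF I_simple simple_function_mono[OF Suc]]) simp
  moreover have "simple_function (\<F> (Suc k)) (X (Suc k)) \<longleftrightarrow>
      simple_function (\<F> (Suc k)) (\<lambda>\<omega>. T k (I k \<omega>) (X k \<omega>))"
    by (rule simple_function_cong) (simp add: X_Suc space_\<F>)
  ultimately show ?case by simp
qed

lemma X_simple_M: "simple_function M (\<lambda>\<omega>. f (X k \<omega>))"
  by (rule simple_function_compose1[OF simple_function_M[OF X_simple]])

lemma X_measurable [measurable]: "X k \<in> borel_measurable M"
  using borel_measurable_simple_function[OF X_simple_M[of "\<lambda>x. x"]] by simp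

lemma integrable_X:
  fixes f :: "'a \<Rightarrow> 'b::{banach, second_countable_topology}"
  shows "integrable M (\<lambda>\<omega>. f (X k \<omega>))"
  by (rule simple_integrable[OF X_simple_M])

lemma step_descent: "\<omega> \<in> space M \<Longrightarrow>
    c1 / \<alpha> k * (norm (X (Suc k) \<omega> - X k \<omega>))\<^sup>2 \<le> D (X k \<omega>) - D (X (Suc k) \<omega>)"
  using T_length I_in by (simp add: X_Suc)

lemma D_Suc_le:
  assumes "\<omega> \<in> space M"
  shows "D (X (Suc k) \<omega>) \<le> D (X k \<omega>)"
proof -
  have "0 \<le> c1 / \<alpha> k * (norm (X (Suc k) \<omega> - X k \<omega>))\<^sup>2"
    using pos step(1)[of k] by simp
  also have "\<dots> \<le> D (X k \<omega>) - D (X (Suc k) \<omega>)"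
    by (rule step_descent[OF assms])
  finally show ?thesis by simp
qed

lemma D_le: "\<omega> \<in> space M \<Longrightarrow> j \<le> k \<Longrightarrow> D (X k \<omega>) \<le> D (X j \<omega>)"
  using lift_Suc_antimono_le[of "\<lambda>k. D (X k \<omega>)"] D_Suc_le by blast

lemma D_le_init: "\<omega> \<in> space M \<Longrightarrow> D (X k \<omega>) \<le> D x0"
  using D_le[of \<omega> 0 k] X_0 by simp

lemma sampled_descent: "\<omega> \<in> space M \<Longrightarrow>
    c1 * \<alpha> k * (v (I k \<omega>) (X k \<omega>) * (G (X k \<omega>))\<^sup>2) \<le> D (X k \<omega>) - D (X (Suc k) \<omega>)"
  using T_descent D_le_init I_in by (simp add: X_Suc)

text \<open>The weight is known at time \<open>k\<close>, so it can be moved inside the conditional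
  expectation of the indicator, whose lower bound \<rho> then applies.\<close>

lemma sampling_lower_bound:
  assumes W: "simple_function (\<F> k) W" "\<And>\<omega>. \<omega> \<in> space M \<Longrightarrow> 0 \<le> W \<omega>" and i: "i \<in> {1..m}"
  shows "\<rho> * (\<integral>\<omega>. W \<omega> \<partial>M) \<le> (\<integral>\<omega>. W \<omega> * indicat_real {\<omega> \<in> space M. I k \<omega> = i} \<omega> \<partial>M)"
proof -
  interpret fs: finite_measure_subalgebra M "\<F> k"
    by unfold_locales (rule subalg)
  let ?J = "{\<omega> \<in> space M. I k \<omega> = i}"
  have "I k -` {i} \<inter> space M \<in> sets M"
    by (rule simple_functionD(2)[OF simple_function_M[OF I_simple]])
  then have J [measurable]: "?J \<in> sets M"
    by (simp add: vimage_def Int_def conj_commute)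
  have "simple_function M (\<lambda>\<omega>. W \<omega> * indicat_real ?J \<omega>)"
    by (intro simple_function_mult simple_function_M[OF W(1)] simple_function_indicator J)
  then have int: "integrable M (\<lambda>\<omega>. W \<omega> * indicat_real ?J \<omega>)"
    by (rule simple_integrable)
  note ce = fs.real_cond_exp_intg[OF int borel_measurable_simple_function[OF W(1)]]
  have "\<rho> * (\<integral>\<omega>. W \<omega> \<partial>M) = (\<integral>\<omega>. \<rho> * W \<omega> \<partial>M)"
    by simp
  also have "\<dots> \<le> (\<integral>\<omega>. W \<omega> * real_cond_exp M (\<F> k) (indicat_real ?J) \<omega> \<partial>M)"
  proof (rule integral_mono_AE)
    show "integrable M (\<lambda>\<omega>. \<rho> * W \<omega>)"
      by (intro integrable_mult_right simple_integrable simple_function_M[OF W(1)])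
    show "integrable M (\<lambda>\<omega>. W \<omega> * real_cond_exp M (\<F> k) (indicat_real ?J) \<omega>)"
      by (rule ce(1)) simp
    show "AE \<omega> in M. \<rho> * W \<omega> \<le> W \<omega> * real_cond_exp M (\<F> k) (indicat_real ?J) \<omega>"
      using I_prob[OF i, of k] AE_space
      by eventually_elim (subst mult.commute, rule mult_left_mono, auto simp: W(2))
  qed
  also have "\<dots> = (\<integral>\<omega>. W \<omega> * indicat_real ?J \<omega> \<partial>M)"
    by (rule ce(2)) simp
  finally show ?thesis .
qed

text \<open>Splitting over the value of \<open>I k\<close> reduces the sampled term to one weighted
  indicator per block, so sampling costs only the factor \<rho> against the sum over all
  blocks.\<close>

lemma sampled_expectation_ge:
  assumes u: "\<And>i. i \<in> {1..m} \<Longrightarrow> simple_function (\<F> k) (u i)"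
    and nn: "\<And>i \<omega>. i \<in> {1..m} \<Longrightarrow> \<omega> \<in> space M \<Longrightarrow> 0 \<le> u i \<omega>"
    and w: "simple_function (\<F> k) w" "\<And>\<omega>. \<omega> \<in> space M \<Longrightarrow> w \<omega> \<le> (\<Sum>i\<in>{1..m}. u i \<omega>)"
  shows "\<rho> * (\<integral>\<omega>. w \<omega> \<partial>M) \<le> (\<integral>\<omega>. u (I k \<omega>) \<omega> \<partial>M)"
proof -
  let ?J = "\<lambda>i. {\<omega> \<in> space M. I k \<omega> = i}"
  have J: "?J i \<in> sets M" for i
  proof -
    have "I k -` {i} \<inter> space M \<in> sets M"
      by (rule simple_functionD(2)[OF simple_function_M[OF I_simple]])
    then show ?thesis
      by (simp add: vimage_def Int_def conj_commute)
  qed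
  have intu: "integrable M (u i)" if "i \<in> {1..m}" for i
    using simple_integrable[OF simple_function_M[OF u[OF that]]] .
  have intJ: "integrable M (\<lambda>\<omega>. u i \<omega> * indicat_real (?J i) \<omega>)" if "i \<in> {1..m}" for i
    by (intro simple_integrable simple_function_mult simple_function_M[OF u[OF that]]
        simple_function_indicator J)
  have "(\<integral>\<omega>. w \<omega> \<partial>M) \<le> (\<integral>\<omega>. (\<Sum>i\<in>{1..m}. u i \<omega>) \<partial>M)"
    by (intro integral_mono w Bochner_Integration.integrable_sum intu
        simple_integrable[OF simple_function_M[OF w(1)]])
  also have "\<dots> = (\<Sum>i\<in>{1..m}. \<integral>\<omega>. u i \<omega> \<partial>M)"
    by (intro Bochner_Integration.integral_sum intu)
  finally have "\<rho> * (\<integral>\<omega>. w \<omega> \<partial>M) \<le> (\<Sum>i\<in>{1..m}. \<rho> * (\<integral>\<omega>. u i \<omega> \<partial>M))"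
    using pos by (simp add: sum_distrib_left[symmetric])
  also have "\<dots> \<le> (\<Sum>i\<in>{1..m}. \<integral>\<omega>. u i \<omega> * indicat_real (?J i) \<omega> \<partial>M)"
    by (intro sum_mono sampling_lower_bound u nn)
  also have "\<dots> = (\<integral>\<omega>. (\<Sum>i\<in>{1..m}. u i \<omega> * indicat_real (?J i) \<omega>) \<partial>M)"
    by (intro Bochner_Integration.integral_sum[symmetric] intJ)
  also have "\<dots> = (\<integral>\<omega>. u (I k \<omega>) \<omega> \<partial>M)"
  proof (rule Bochner_Integration.integral_cong[OF refl])
    fix \<omega> assume \<omega>: "\<omega> \<in> space M"
    have "(\<Sum>i\<in>{1..m}. u i \<omega> * indicat_real (?J i) \<omega>) = (\<Sum>i\<in>{1..m}. if i = I k \<omega> then u i \<omega> else 0)"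
      using \<omega> by (intro sum.cong) (auto simp: indicator_def)
    also have "\<dots> = u (I k \<omega>) \<omega>"
      using I_in[OF \<omega>, of k] by simp
    finally show "(\<Sum>i\<in>{1..m}. u i \<omega> * indicat_real (?J i) \<omega>) = u (I k \<omega>) \<omega>" .
  qed
  finally show ?thesis .
qed

subsection \<open>Lower tail of the accumulated progress\<close>

text \<open>The random counterpart of \<open>A\<close>: as long as the gap is positive, the
  potential has risen by at least \<open>c1 * progress k\<close>.\<close>

definition progress :: "nat \<Rightarrow> 'w \<Rightarrow> real" where
  "progress k \<omega> = (\<Sum>j<k. \<alpha> j * v (I j \<omega>) (X j \<omega>))"

lemma progress_Suc: "progress (Suc k) \<omega> = progress k \<omega> + \<alpha> k * v (I k \<omega>) (X k \<omega>)"
  by (simp add: progress_def)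

lemma progress_mono: "\<omega> \<in> space M \<Longrightarrow> j \<le> k \<Longrightarrow> progress j \<omega> \<le> progress k \<omega>"
  unfolding progress_def
  by (intro sum_mono2 mult_nonneg_nonneg less_imp_le[OF step(1)] v_bounds(1) I_in) auto

lemma progress_simple: "simple_function (\<F> k) (progress k)"
proof (induction k)
  case 0
  then show ?case by (simp add: progress_def)
next
  case (Suc k)
  have "simple_function (\<F> (Suc k)) (\<lambda>\<omega>. v (I k \<omega>) (X k \<omega>))"
    by (rule simple_function_compose2[where h = v, OF I_simple simple_function_mono[OF X_simple]]) simp
  then show ?case
    using simple_function_mono[OF Suc, of "Suc k"] unfolding progress_Suc
    by (intro simple_function_add simple_function_mult simple_function_const) auto
qed

text \<open>The number \<open>ln 2\<close> minimizes \<open>s / 2 - (1 - exp (- s))\<close>, the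
  Chernoff exponent for half of the guaranteed mean progress; the minimum
  \<open>- (1 - ln 2) / 2\<close> is the constant in the expected rate.\<close>

definition \<theta> :: real where "\<theta> = ln 2 / (abar * c3)"

lemma \<theta>_pos: "0 < \<theta>"
  using abar_pos pos by (simp add: \<theta>_def)

text \<open>Given the past, the chord bound makes the new factor affine in the sampled share, whose
  conditional mean is at least \<open>c2\<close>; the resulting factor \<open>1 - r * c2\<close> is
  at most an exponential.\<close>

lemma expectation_exp_progress_le:
  "(\<integral>\<omega>. exp (- \<theta> * progress k \<omega>) \<partial>M) \<le> exp (- (c2 / (2 * abar * c3)) * A k)"
proof (induction k)
  case 0
  then show ?case by (simp add: progress_def A_def prob_space)
next
  case (Suc k)
  define Z where "Z \<omega> = exp (- \<theta> * progress k \<omega>)" for \<omega>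
  \<comment> \<open>The slope of the chord bound \<open>1 - s / 2\<close> at
    \<open>s = \<alpha> k * v / (abar * c3)\<close>, taken with respect to the share
    \<open>v\<close>.\<close>
  define r where "r = \<alpha> k / (2 * abar * c3)"
  have r: "0 < r"
    using step(1) abar_pos pos by (simp add: r_def)
  have Z: "simple_function (\<F> k) Z"
    unfolding Z_def by (rule simple_function_compose1[OF progress_simple])
  have Zv: "simple_function (\<F> k) (\<lambda>\<omega>. Z \<omega> * v i (X k \<omega>))" for i
    by (intro simple_function_mult Z simple_function_compose1[OF X_simple])
  have ZvI: "simple_function M (\<lambda>\<omega>. Z \<omega> * v (I k \<omega>) (X k \<omega>))"
    by (intro simple_function_mult simple_function_M[OF Z] simple_function_compose2[where h = v,
        OF simple_function_M[OF I_simple] simple_function_M[OF X_simple]])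
  have "exp (- \<theta> * progress (Suc k) \<omega>) \<le> Z \<omega> - r * (Z \<omega> * v (I k \<omega>) (X k \<omega>))"
    if \<omega>: "\<omega> \<in> space M" for \<omega>
  proof -
    let ?v = "v (I k \<omega>) (X k \<omega>)"
    have v: "0 \<le> ?v" "?v \<le> c3"
      using v_bounds I_in[OF \<omega>] by auto
    have "\<alpha> k * ?v \<le> abar * c3"
      using v step abar_pos by (intro mult_mono) (auto intro: less_imp_le)
    then have "exp (- (ln 2 * (\<alpha> k * ?v / (abar * c3)))) \<le> 1 - \<alpha> k * ?v / (abar * c3) / 2"
      using v step(1)[of k] abar_pos pos by (intro exp_minus_ln_2_le) auto
    then have "exp (- \<theta> * (\<alpha> k * ?v)) \<le> 1 - r * ?v"
      by (simp add: \<theta>_def r_def mult_ac)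
    then have "Z \<omega> * exp (- \<theta> * (\<alpha> k * ?v)) \<le> Z \<omega> * (1 - r * ?v)"
      by (intro mult_left_mono) (auto simp: Z_def)
    then show ?thesis
      by (simp add: Z_def progress_Suc exp_add[symmetric] algebra_simps)
  qed
  then have "(\<integral>\<omega>. exp (- \<theta> * progress (Suc k) \<omega>) \<partial>M)
      \<le> (\<integral>\<omega>. Z \<omega> - r * (Z \<omega> * v (I k \<omega>) (X k \<omega>)) \<partial>M)"
    by (intro integral_mono simple_integrable simple_function_compose1[OF simple_function_M[OF progress_simple]]
        simple_function_diff simple_function_mult simple_function_const simple_function_M[OF Z] ZvI)
      (auto intro: ZvI)
  also have "\<dots> = (\<integral>\<omega>. Z \<omega> \<partial>M) - r * (\<integral>\<omega>. Z \<omega> * v (I k \<omega>) (X k \<omega>) \<partial>M)"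
    using simple_integrable[OF simple_function_M[OF Z]] simple_integrable[OF ZvI] by simp
  also have "\<dots> \<le> (\<integral>\<omega>. Z \<omega> \<partial>M) - r * (\<rho> * (\<integral>\<omega>. \<mu> * Z \<omega> \<partial>M))"
  proof (intro diff_left_mono mult_left_mono)
    show "\<rho> * (\<integral>\<omega>. \<mu> * Z \<omega> \<partial>M) \<le> (\<integral>\<omega>. Z \<omega> * v (I k \<omega>) (X k \<omega>) \<partial>M)"
    proof (rule sampled_expectation_ge[where u = "\<lambda>i \<omega>. Z \<omega> * v i (X k \<omega>)", OF Zv])
      show "simple_function (\<F> k) (\<lambda>\<omega>. \<mu> * Z \<omega>)"
        by (intro simple_function_mult simple_function_const Z)
      show "\<mu> * Z \<omega> \<le> (\<Sum>i\<in>{1..m}. Z \<omega> * v i (X k \<omega>))" for \<omega>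
        using mult_left_mono[OF v_sum, of "Z \<omega>" "X k \<omega>"]
        unfolding sum_distrib_left by (simp add: Z_def mult.commute)
    qed (use v_bounds in \<open>auto simp: Z_def\<close>)
  qed (use r in simp)
  also have "\<dots> = (1 - r * c2) * (\<integral>\<omega>. Z \<omega> \<partial>M)"
    by (simp add: c2_def algebra_simps)
  also have "\<dots> \<le> exp (- (r * c2)) * (\<integral>\<omega>. Z \<omega> \<partial>M)"
    using exp_ge_add_one_self[of "- (r * c2)"]
    by (intro mult_right_mono integral_nonneg_AE) (auto simp: Z_def)
  also have "\<dots> \<le> exp (- (r * c2)) * exp (- (c2 / (2 * abar * c3)) * A k)"
    using Suc unfolding Z_def by (intro mult_left_mono) auto
  also have "\<dots> = exp (- (c2 / (2 * abar * c3)) * A (Suc k))"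
    by (simp add: A_Suc r_def exp_add[symmetric] add_divide_distrib algebra_simps)
  finally show ?case .
qed

text \<open>It is at least \<open>1\<close> exactly when the progress does not exceed
  \<open>c2 / 2 * A k\<close>, so its expectation is the Chernoff bound for that event.\<close>

definition deficit :: "nat \<Rightarrow> 'w \<Rightarrow> real" where
  "deficit k \<omega> = exp (- \<theta> * (progress k \<omega> - c2 / 2 * A k))"

lemma deficit_simple: "simple_function M (deficit k)"
  unfolding deficit_def by (rule simple_function_compose1[OF simple_function_M[OF progress_simple]])

lemma expectation_deficit_le:
  "(\<integral>\<omega>. deficit k \<omega> \<partial>M) \<le> exp (- ((1 - ln 2) / 2) * (c2 / (c3 * abar)) * A k)"
proof -
  have "deficit k \<omega> = exp (\<theta> * (c2 / 2 * A k)) * exp (- \<theta> * progress k \<omega>)" for \<omega>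
    unfolding deficit_def by (simp add: exp_add[symmetric] algebra_simps)
  then have "(\<integral>\<omega>. deficit k \<omega> \<partial>M) = exp (\<theta> * (c2 / 2 * A k)) * (\<integral>\<omega>. exp (- \<theta> * progress k \<omega>) \<partial>M)"
    by simp
  also have "\<dots> \<le> exp (\<theta> * (c2 / 2 * A k)) * exp (- (c2 / (2 * abar * c3)) * A k)"
    by (intro mult_left_mono expectation_exp_progress_le) auto
  also have "\<dots> = exp (- ((1 - ln 2) / 2) * (c2 / (c3 * abar)) * A k)"
    using abar_pos pos by (simp add: exp_add[symmetric] \<theta>_def field_simps)
  finally show ?thesis .
qed

text \<open>Borel--Cantelli along the indices where \<open>A\<close> passes the integers; monotonicity covers the
  indices in between, so that the step sizes may be arbitrarily small.\<close>

lemma AE_progress_eventually_ge: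
  "AE \<omega> in M. \<forall>C. \<exists>N. \<forall>k\<ge>N. C + c2 / 2 * A k \<le> progress k \<omega>"
proof -
  define \<kappa> where "\<kappa> n = (LEAST k. real n \<le> A k)" for n :: nat
  have \<kappa>: "real n \<le> A (\<kappa> n)" for n
    unfolding \<kappa>_def by (rule LeastI_ex) (rule A_unbounded)
  have \<kappa>_le: "\<kappa> n \<le> k" if "real n \<le> A k" for n k
    unfolding \<kappa>_def using that by (rule Least_le)
  define q where "q = exp (- ((1 - ln 2) / 2) * (c2 / (c3 * abar)))"
  have "ln 2 < (1::real)"
    using ln_2_less_1 .
  then have "((1 - ln 2) / 2) * (c2 / (c3 * abar)) > 0"
    using c2_pos pos abar_pos by simp
  then have q: "0 < q" "q < 1"
    by (auto simp: q_def)
  have Eq: "(\<integral>\<omega>. deficit (\<kappa> n) \<omega> \<partial>M) \<le> q ^ n" for n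
  proof -
    have "((1 - ln 2) / 2) * (c2 / (c3 * abar)) * real n \<le> ((1 - ln 2) / 2) * (c2 / (c3 * abar)) * A (\<kappa> n)"
      using \<open>((1 - ln 2) / 2) * (c2 / (c3 * abar)) > 0\<close> \<kappa> by (intro mult_left_mono) auto
    then have "exp (- ((1 - ln 2) / 2) * (c2 / (c3 * abar)) * A (\<kappa> n))
        \<le> exp (real n * (- ((1 - ln 2) / 2) * (c2 / (c3 * abar))))"
      by (simp add: mult_ac)
    also have "\<dots> = q ^ n"
      unfolding q_def by (rule exp_of_nat_mult)
    finally show ?thesis
      using expectation_deficit_le[of "\<kappa> n"] by linarith
  qed
  have "AE \<omega> in M. summable (\<lambda>n. deficit (\<kappa> n) \<omega>)"
  proof (rule AE_summable_of_bounded_integrals[where B = "1 / (1 - q)"])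
    fix N
    have "(\<Sum>n<N. \<integral>\<omega>. deficit (\<kappa> n) \<omega> \<partial>M) \<le> (\<Sum>n<N. q ^ n)"
      by (intro sum_mono Eq)
    also have "\<dots> \<le> (\<Sum>n. q ^ n)"
      using q by (intro sum_le_suminf summable_geometric) auto
    also have "\<dots> = 1 / (1 - q)"
      using q by (intro suminf_geometric) auto
    finally show "(\<Sum>n<N. \<integral>\<omega>. deficit (\<kappa> n) \<omega> \<partial>M) \<le> 1 / (1 - q)" .
  qed (rule simple_integrable[OF deficit_simple], simp add: deficit_def)
  then show ?thesis
    using AE_space
  proof eventually_elim
    case (elim \<omega>)
    show ?case
    proof
      fix C
      have "(\<lambda>n. deficit (\<kappa> n) \<omega>) \<longlonglongrightarrow> 0"
        using elim(1) by (rule summable_LIMSEQ_zero)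
      \<comment> \<open>The slack \<open>c2 / 2\<close> pays for the later passage from
        \<open>\<kappa> n\<close> to an index \<open>k\<close> with \<open>A k < n + 1\<close>,
        where \<open>A k\<close> exceeds \<open>A (\<kappa> n)\<close> by at most
        \<open>1\<close>.\<close>
      then have "\<forall>\<^sub>F n in sequentially. deficit (\<kappa> n) \<omega> < exp (- \<theta> * (C + c2 / 2))"
        by (rule order_tendstoD) simp
      then obtain N where N: "\<And>n. n \<ge> N \<Longrightarrow> deficit (\<kappa> n) \<omega> < exp (- \<theta> * (C + c2 / 2))"
        by (auto simp: eventually_sequentially)
      have N': "C + c2 / 2 < progress (\<kappa> n) \<omega> - c2 / 2 * A (\<kappa> n)" if "n \<ge> N" for n
        using N[OF that] \<theta>_pos by (simp add: deficit_def)
      obtain K where K: "real N \<le> A K"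
        using A_unbounded by blast
      have "C + c2 / 2 * A k \<le> progress k \<omega>" if "K \<le> k" for k
      proof -
        define n where "n = nat \<lfloor>A k\<rfloor>"
        have n: "real n \<le> A k" "A k < real n + 1"
          using A_nonneg[of k] by (auto simp: n_def)
        have "real N \<le> A k"
          using K A_mono[OF that] by linarith
        then have "N \<le> n"
          by (simp add: n_def le_nat_floor)
        then have "C + c2 / 2 < progress (\<kappa> n) \<omega> - c2 / 2 * A (\<kappa> n)"
          by (rule N')
        moreover have "progress (\<kappa> n) \<omega> \<le> progress k \<omega>"
          by (intro progress_mono elim \<kappa>_le n)
        moreover have "c2 / 2 * A k \<le> c2 / 2 * A (\<kappa> n) + c2 / 2"
          using mult_left_mono[of "A k" "A (\<kappa> n) + 1" "c2 / 2"] c2_pos n \<kappa>[of n]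
          by (simp add: distrib_left)
        ultimately show ?thesis by linarith
      qed
      then show "\<exists>N. \<forall>k\<ge>N. C + c2 / 2 * A k \<le> progress k \<omega>"
        by blast
    qed
  qed
qed

subsection \<open>Decay of the objective gap\<close>

text \<open>A positive gap at time \<open>k\<close> forces positive gaps before, so the KL
  inequality applies at every step and cancels the gradient norm in
  \<open>sampled_descent\<close>.\<close>

lemma potential_gap_ge:
  assumes \<omega>: "\<omega> \<in> space M" and D: "0 < D (X k \<omega>)"
  shows "kl.potential t0 (D x0) + c1 * progress k \<omega> \<le> kl.potential t0 (D (X k \<omega>))"
  using D
proof (induction k)
  case 0
  then show ?case using X_0[OF \<omega>] by (simp add: progress_def)
next
  case (Suc k)
  let ?x = "X k \<omega>" and ?y = "X (Suc k) \<omega>"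
  have le: "D ?y \<le> D ?x" and Dx: "0 < D ?x"
    using D_Suc_le[OF \<omega>, of k] Suc.prems by auto
  have v: "0 \<le> v (I k \<omega>) ?x"
    using v_bounds(1) I_in[OF \<omega>] by blast
  have "1\<^sup>2 \<le> (deriv \<phi> (D ?x) * G ?x)\<^sup>2"
    using KL[OF Dx] by (intro power_mono) auto
  then have "c1 * \<alpha> k * v (I k \<omega>) ?x * 1 \<le> c1 * \<alpha> k * v (I k \<omega>) ?x * (deriv \<phi> (D ?x) * G ?x)\<^sup>2"
    using pos step(1)[of k] v by (intro mult_left_mono) auto
  also have "\<dots> = (deriv \<phi> (D ?x))\<^sup>2 * (c1 * \<alpha> k * (v (I k \<omega>) ?x * (G ?x)\<^sup>2))"
    by (simp add: power_mult_distrib)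
  also have "\<dots> \<le> (deriv \<phi> (D ?x))\<^sup>2 * (D ?x - D ?y)"
    by (intro mult_left_mono sampled_descent \<omega>) auto
  also have "\<dots> \<le> kl.potential t0 (D ?y) - kl.potential t0 (D ?x)"
    by (rule kl.potential_diff_ge[OF pos(5) Suc.prems le])
  finally show ?case
    using Suc.IH[OF Dx] by (simp add: progress_Suc algebra_simps)
qed

text \<open>The curve starts at \<open>t0\<close> instead of the initial gap; in the almost sure
  statement an arbitrary constant surplus of the progress absorbs the difference.\<close>

definition rate :: "nat \<Rightarrow> real" where
  "rate k = KL_psi_inv \<phi> t0 (ereal (c1 * c2 / 2 * A k))"

lemma rate: "0 < rate k" "kl.potential t0 (rate k) = c1 * c2 / 2 * A k"
proof -
  have "kl.potential t0 t0 \<le> c1 * c2 / 2 * A k"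
    using A_nonneg[of k] pos c2_pos by (simp add: kl.potential_refl)
  from kl.KL_psi_inv[OF pos(5) pos(5) this]
  show "0 < rate k" "kl.potential t0 (rate k) = c1 * c2 / 2 * A k"
    by (simp_all add: rate_def)
qed

lemma rate_le_iff: "0 < t \<Longrightarrow> rate k \<le> t \<longleftrightarrow> kl.potential t0 t \<le> c1 * c2 / 2 * A k"
  using kl.potential_le_iff[OF pos(5) rate(1)[of k], of t] rate(2)[of k] by simp

lemma le_rate_iff: "0 < t \<Longrightarrow> t \<le> rate k \<longleftrightarrow> c1 * c2 / 2 * A k \<le> kl.potential t0 t"
  using kl.potential_le_iff[OF pos(5) _ rate(1)[of k], of t] rate(2)[of k] by simp

lemma rate_antimono: "j \<le> k \<Longrightarrow> rate k \<le> rate j"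
  using A_mono[of j k] pos c2_pos by (simp add: rate_le_iff rate)

lemma rate_eventually_le:
  assumes "0 < e"
  shows "\<exists>N. \<forall>k\<ge>N. rate k \<le> e"
proof -
  obtain N where "kl.potential t0 e / (c1 * c2 / 2) \<le> A N"
    using A_unbounded by blast
  then have "rate N \<le> e"
    using pos c2_pos by (simp add: rate_le_iff[OF assms] field_simps)
  then show ?thesis
    using rate_antimono order_trans by blast
qed

text \<open>The bound holds pointwise before taking expectations: with enough progress the gap is at
  most \<open>B\<close>, and otherwise the deficit is at least \<open>1\<close> and multiplies the
  initial gap.\<close>

lemma expected_gap_le:
  "(\<integral>\<omega>. D (X k \<omega>) \<partial>M) \<le> exp (- ((1 - ln 2) / 2) * (c2 / (c3 * abar)) * A k) * D x0
      + KL_psi_inv \<phi> t0 (KL_psi \<phi> t0 (D x0) + ereal (c1 * c2 / 2 * A k))"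
proof -
  define B where "B = KL_psi_inv \<phi> t0 (KL_psi \<phi> t0 (D x0) + ereal (c1 * c2 / 2 * A k))"
  have pw: "D (X k \<omega>) \<le> deficit k \<omega> * D x0 + B" if \<omega>: "\<omega> \<in> space M" for \<omega>
  proof (cases "D x0 = 0")
    \<comment> \<open>Here the potential starts at infinity, so \<open>B\<close> is the inverse at
      infinity, which is \<open>0\<close>.\<close>
    case True
    then have "B = 0"
      by (simp add: B_def kl.KL_psi_eq kl.KL_psi_inv_infinity)
    then show ?thesis
      using D_le_init[OF \<omega>, of k] True by simp
  next
    case False
    then have D0: "0 < D x0"
      using D_nonneg[of x0] by linarith
    let ?y = "kl.potential t0 (D x0) + c1 * c2 / 2 * A k"
    have B: "B = KL_psi_inv \<phi> t0 (ereal ?y)"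
      using False by (simp add: B_def kl.KL_psi_eq)
    have y: "kl.potential t0 (D x0) \<le> ?y"
      using A_nonneg[of k] pos c2_pos by simp
    have Bpos: "0 < B"
      unfolding B by (rule kl.KL_psi_inv(1)[OF pos(5) D0 y])
    show ?thesis
    proof (cases "c2 / 2 * A k \<le> progress k \<omega>")
      case True
      have "D (X k \<omega>) \<le> B"
      proof (cases "D (X k \<omega>) = 0")
        case False
        then have Dk: "0 < D (X k \<omega>)"
          using D_nonneg[of "X k \<omega>"] by linarith
        have "c1 * (c2 / 2 * A k) \<le> c1 * progress k \<omega>"
          using True pos by (intro mult_left_mono) auto
        then have "?y \<le> kl.potential t0 (D (X k \<omega>))"
          using potential_gap_ge[OF \<omega> Dk] by simp
        then show ?thesis
          unfolding B by (rule kl.le_KL_psi_inv[OF pos(5) D0 y Dk])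
      qed (use Bpos in simp)
      moreover have "0 \<le> deficit k \<omega> * D x0"
        using D0 by (simp add: deficit_def)
      ultimately show ?thesis by linarith
    next
      case False
      then have "1 \<le> deficit k \<omega>"
        using \<theta>_pos by (simp add: deficit_def mult_le_0_iff)
      then have "1 * D x0 \<le> deficit k \<omega> * D x0"
        using D0 by (intro mult_right_mono) auto
      then show ?thesis
        using D_le_init[OF \<omega>, of k] Bpos by linarith
    qed
  qed
  have "(\<integral>\<omega>. D (X k \<omega>) \<partial>M) \<le> (\<integral>\<omega>. deficit k \<omega> * D x0 + B \<partial>M)"
    using pw simple_integrable[OF deficit_simple[of k]]
    by (intro integral_mono integrable_X) auto
  also have "\<dots> = (\<integral>\<omega>. deficit k \<omega> \<partial>M) * D x0 + B"
    using simple_integrable[OF deficit_simple[of k]] by (simp add: prob_space)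
  also have "\<dots> \<le> exp (- ((1 - ln 2) / 2) * (c2 / (c3 * abar)) * A k) * D x0 + B"
    by (intro add_right_mono mult_right_mono expectation_deficit_le D_nonneg)
  finally show ?thesis
    by (simp only: B_def)
qed

text \<open>The shift from \<open>k\<close> to \<open>Suc k\<close> is affordable because the progress exceeds its threshold by
  any constant; it aligns the two telescoping sums in \<open>step_length_le_rate\<close> and thereby yields
  the sharp constant there.\<close>

lemma eventually_le_rate_Suc:
  assumes \<omega>: "\<omega> \<in> space M" and ev: "\<forall>C. \<exists>N. \<forall>k\<ge>N. C + c2 / 2 * A k \<le> progress k \<omega>"
  shows "\<exists>N. \<forall>k\<ge>N. D (X k \<omega>) \<le> rate (Suc k)"
proof -
  \<comment> \<open>The term \<open>c2 / 2 * abar\<close> pays for replacing \<open>A k\<close> by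
    \<open>A (Suc k)\<close>; the other term removes the initial value of the potential.\<close>
  obtain N where N: "\<And>k. k \<ge> N \<Longrightarrow>
      (c2 / 2 * abar - kl.potential t0 (D x0) / c1) + c2 / 2 * A k \<le> progress k \<omega>"
    using ev by blast
  have "D (X k \<omega>) \<le> rate (Suc k)" if k: "N \<le> k" for k
  proof (cases "D (X k \<omega>) = 0")
    case False
    then have Dk: "0 < D (X k \<omega>)"
      using D_nonneg[of "X k \<omega>"] by linarith
    have "c1 * ((c2 / 2 * abar - kl.potential t0 (D x0) / c1) + c2 / 2 * A k) \<le> c1 * progress k \<omega>"
      using N[OF k] pos by (intro mult_left_mono) auto
    then have "c1 * c2 / 2 * (A k + abar) \<le> kl.potential t0 (D (X k \<omega>))"
      using potential_gap_ge[OF \<omega> Dk] pos by (simp add: algebra_simps)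
    moreover have "c1 * c2 / 2 * A (Suc k) \<le> c1 * c2 / 2 * (A k + abar)"
      using step(2)[of k] pos c2_pos by (intro mult_left_mono) (auto simp: A_Suc)
    ultimately show ?thesis
      by (simp add: le_rate_iff[OF Dk])
  qed (use rate(1)[of "Suc k"] in simp)
  then show ?thesis by blast
qed

text \<open>The slope \<open>f\<close> at \<open>rate (Suc k)\<close> links both decrements:
  \<open>f * p\<close> dominates the increase of the potential along the rate, and since the gap is
  at most \<open>rate (Suc k)\<close>, concavity gives \<open>f * \<delta> \<le> q\<close>. Hence
  the squared step is at most \<open>K\<^sup>2 * (p * q)\<close>, and the geometric mean is at most
  the arithmetic one.\<close>

lemma step_length_le_rate:
  assumes \<omega>: "\<omega> \<in> space M" and le: "D (X k \<omega>) \<le> rate (Suc k)"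
  shows "norm (X (Suc k) \<omega> - X k \<omega>) \<le> sqrt 2 / (c1 * sqrt c2) *
    (((\<phi> (rate k) - \<phi> (rate (Suc k))) + (\<phi> (D (X k \<omega>)) - \<phi> (D (X (Suc k) \<omega>)))) / 2)"
proof -
  define N where "N = norm (X (Suc k) \<omega> - X k \<omega>)"
  define \<delta> where "\<delta> = D (X k \<omega>) - D (X (Suc k) \<omega>)"
  define f where "f = deriv \<phi> (rate (Suc k))"
  define p where "p = \<phi> (rate k) - \<phi> (rate (Suc k))"
  define q where "q = \<phi> (D (X k \<omega>)) - \<phi> (D (X (Suc k) \<omega>))"
  define K where "K = sqrt 2 / (c1 * sqrt c2)"
  have K: "0 < K" "K\<^sup>2 = 2 / (c1\<^sup>2 * c2)"
    using pos c2_pos by (simp_all add: K_def power_divide power_mult_distrib)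
  have f: "0 < f"
    unfolding f_def by (rule kl.deriv_pos[OF rate(1)])
  have \<delta>: "0 \<le> \<delta>"
    using D_Suc_le[OF \<omega>, of k] by (simp add: \<delta>_def)
  have p: "0 \<le> p"
    using kl.mono[of "rate (Suc k)" "rate k"] rate_antimono[of k "Suc k"] rate(1)[of "Suc k"]
    by (simp add: p_def)
  have "c1 * c2 / 2 * \<alpha> k = kl.potential t0 (rate (Suc k)) - kl.potential t0 (rate k)"
    by (simp add: rate(2) A_Suc algebra_simps)
  also have "\<dots> \<le> f * p"
    unfolding f_def p_def by (intro kl.potential_diff_le pos rate rate_antimono) simp
  finally have ap: "c1 * c2 / 2 * \<alpha> k \<le> f * p" .
  have fq: "f * \<delta> \<le> q"
  proof (cases "D (X k \<omega>) = 0")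
    case True
    then show ?thesis
      using D_Suc_le[OF \<omega>, of k] D_nonneg[of "X (Suc k) \<omega>"] by (simp add: \<delta>_def q_def)
  next
    case False
    then have Dk: "0 < D (X k \<omega>)"
      using D_nonneg[of "X k \<omega>"] by linarith
    have "f * \<delta> \<le> deriv \<phi> (D (X k \<omega>)) * \<delta>"
      unfolding f_def by (intro mult_right_mono kl.deriv_antimono Dk le \<delta>)
    also have "\<dots> \<le> q"
      using kl.tangent[OF Dk D_nonneg, of "X (Suc k) \<omega>"]
      by (simp add: q_def \<delta>_def algebra_simps)
    finally show ?thesis .
  qed
  have q: "0 \<le> q"
    using mult_nonneg_nonneg[OF less_imp_le[OF f] \<delta>] fq by linarith
  have "c1 / \<alpha> k * N\<^sup>2 \<le> \<delta>"
    using step_descent[OF \<omega>, of k] by (simp add: N_def \<delta>_def)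
  then have "N\<^sup>2 \<le> \<alpha> k * \<delta> / c1"
    using pos step(1)[of k] by (simp add: field_simps)
  also have "\<dots> = 2 / (c1\<^sup>2 * c2) * ((c1 * c2 / 2 * \<alpha> k) * \<delta>)"
    using pos c2_pos by (simp add: field_simps power2_eq_square)
  also have "\<dots> \<le> 2 / (c1\<^sup>2 * c2) * ((f * p) * \<delta>)"
    using pos c2_pos \<delta> by (intro mult_left_mono mult_right_mono ap) auto
  also have "\<dots> = K\<^sup>2 * (p * (f * \<delta>))"
    by (simp add: K)
  also have "\<dots> \<le> K\<^sup>2 * (p * q)"
    by (intro mult_left_mono fq p) auto
  also have "\<dots> \<le> K\<^sup>2 * ((p + q) / 2)\<^sup>2"
  proof (rule mult_left_mono)
    show "p * q \<le> ((p + q) / 2)\<^sup>2"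
      using zero_le_power2[of "p - q"] by (simp add: power2_eq_square algebra_simps)
  qed simp
  finally have "N\<^sup>2 \<le> (K * ((p + q) / 2))\<^sup>2"
    by (simp only: power_mult_distrib)
  then have "N \<le> K * ((p + q) / 2)"
    by (rule power2_le_imp_le) (use K p q in simp)
  then show ?thesis
    unfolding N_def K_def p_def q_def .
qed

text \<open>The averages \<open>\<Phi> j\<close> of \<phi> along the rate and along the trajectory
  telescope. At the initial index the gap is at most the rate, so the average is at most
  \<open>\<phi> (rate k)\<close> and no constant is lost.\<close>

lemma distance_le_rate:
  assumes \<omega>: "\<omega> \<in> space M" and le: "\<And>k. k \<ge> N \<Longrightarrow> D (X k \<omega>) \<le> rate (Suc k)"
    and lim: "(\<lambda>k. X k \<omega>) \<longlonglongrightarrow> x" and k: "k \<ge> N"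
  shows "norm (X k \<omega> - x) \<le> sqrt 2 / (c1 * sqrt c2) * \<phi> (rate k)"
proof -
  define K where "K = sqrt 2 / (c1 * sqrt c2)"
  have K: "0 < K"
    using pos c2_pos by (simp add: K_def)
  define \<Phi> where "\<Phi> j = (\<phi> (rate j) + \<phi> (D (X j \<omega>))) / 2" for j
  have \<Phi>: "0 \<le> \<Phi> j" for j
    using kl.nonneg[of "rate j"] kl.nonneg[OF D_nonneg, of "X j \<omega>"] rate(1)[of j]
    by (simp add: \<Phi>_def)
  have tele: "norm (X k \<omega> - X j \<omega>) \<le> K * (\<Phi> k - \<Phi> j)" if "k \<le> j" for j
    using that
  proof (induction j rule: dec_induct)
    case (step j)
    have "((\<phi> (rate j) - \<phi> (rate (Suc j))) + (\<phi> (D (X j \<omega>)) - \<phi> (D (X (Suc j) \<omega>)))) / 2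
        = \<Phi> j - \<Phi> (Suc j)"
      by (simp add: \<Phi>_def field_simps)
    then have "norm (X (Suc j) \<omega> - X j \<omega>) \<le> K * (\<Phi> j - \<Phi> (Suc j))"
      using step_length_le_rate[OF \<omega> le[of j]] step(1) k by (simp only: K_def)
    moreover have "norm (X k \<omega> - X (Suc j) \<omega>)
        \<le> norm (X k \<omega> - X j \<omega>) + norm (X (Suc j) \<omega> - X j \<omega>)"
      using norm_triangle_ineq4[of "X k \<omega> - X j \<omega>" "X (Suc j) \<omega> - X j \<omega>"] by simp
    ultimately show ?case
      using step.IH by (simp add: algebra_simps)
  qed simp
  have "(\<lambda>j. norm (X k \<omega> - X j \<omega>)) \<longlonglongrightarrow> norm (X k \<omega> - x)"
    by (intro tendsto_intros lim)
  moreover have "norm (X k \<omega> - X j \<omega>) \<le> K * \<Phi> k" if "k \<le> j" for j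
    using tele[OF that] mult_nonneg_nonneg[OF less_imp_le[OF K] \<Phi>[of j]]
    by (simp add: algebra_simps)
  ultimately have "norm (X k \<omega> - x) \<le> K * \<Phi> k"
    by (intro LIMSEQ_le_const2) auto
  also have "\<dots> \<le> K * \<phi> (rate k)"
  proof (intro mult_left_mono)
    have "D (X k \<omega>) \<le> rate k"
      using le[OF k] rate_antimono[of k "Suc k"] by linarith
    then show "\<Phi> k \<le> \<phi> (rate k)"
      using kl.mono[OF D_nonneg, of "X k \<omega>" "rate k"] by (simp add: \<Phi>_def)
  qed (use K in simp)
  finally show ?thesis by (simp add: K_def)
qed

subsection \<open>Convergence of the iterates\<close>

definition mean_phi :: "nat \<Rightarrow> real" where
  "mean_phi k = (\<integral>\<omega>. \<phi> (D (X k \<omega>)) \<partial>M)"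

lemma mean_phi_nonneg: "0 \<le> mean_phi k"
  unfolding mean_phi_def by (intro integral_nonneg_AE AE_I2 kl.nonneg D_nonneg)

text \<open>Jensen's inequality through the tangent at the mean; mean zero is separate, since \<phi>
  need not have a tangent at \<open>0\<close> and the gap then vanishes almost surely.\<close>

lemma mean_phi_le: "mean_phi k \<le> \<phi> (\<integral>\<omega>. D (X k \<omega>) \<partial>M)"
proof -
  define e where "e = (\<integral>\<omega>. D (X k \<omega>) \<partial>M)"
  have e: "0 \<le> e"
    unfolding e_def by (intro integral_nonneg_AE AE_I2 D_nonneg)
  show ?thesis
  proof (cases "e = 0")
    case True
    then have "AE \<omega> in M. D (X k \<omega>) = 0"
      unfolding e_def using integral_nonneg_eq_0_iff_AE[OF integrable_X[of D k]] D_nonneg by simp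
    then have "mean_phi k = (\<integral>\<omega>. 0 \<partial>M)"
      unfolding mean_phi_def
      by (intro integral_cong_AE borel_measurable_integrable integrable_X)
        (auto simp: kl.zero)
    then show ?thesis
      using True kl.zero by (simp add: e_def)
  next
    case False
    with e have e': "0 < e" by simp
    have "mean_phi k \<le> (\<integral>\<omega>. \<phi> e + deriv \<phi> e * (D (X k \<omega>) - e) \<partial>M)"
      unfolding mean_phi_def
      by (intro integral_mono integrable_X kl.tangent e' D_nonneg)
    also have "\<dots> = \<phi> e"
      using integrable_X[of D k] by (simp add: prob_space e_def)
    finally show ?thesis by (simp only: e_def)
  qed
qed

text \<open>The slope of \<phi> at the current gap multiplies \<open>sampled_descent\<close>:
  concavity turns the right side into a decrement of \<phi>, and the KL inequality cancels one of
  the two gradient factors.\<close>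

lemma mean_phi_decrease: "c1 * c2 * \<alpha> k * (\<integral>\<omega>. G (X k \<omega>) \<partial>M) \<le> mean_phi k - mean_phi (Suc k)"
proof -
  \<comment> \<open>At zero gap the slope is replaced by the value \<open>0\<close>;
    \<open>stationary\<close> keeps \<open>G x \<le> d x\<close> there.\<close>
  define d where "d x = (if 0 < D x then deriv \<phi> (D x) * (G x)\<^sup>2 else 0)" for x
  have d_ge: "G x \<le> d x" for x
  proof (cases "0 < D x")
    case True
    then have "1 * G x \<le> (deriv \<phi> (D x) * G x) * G x"
      by (intro mult_right_mono KL G_nonneg)
    then show ?thesis
      using True by (simp add: d_def power2_eq_square mult.assoc)
  next
    case False
    then show ?thesis
      using D_nonneg[of x] stationary[of x] by (simp add: d_def)
  qed
  have d_nonneg: "0 \<le> d x" for x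
    using d_ge[of x] G_nonneg[of x] by linarith
  have ineq: "c1 * \<alpha> k * (v (I k \<omega>) (X k \<omega>) * d (X k \<omega>)) \<le> \<phi> (D (X k \<omega>)) - \<phi> (D (X (Suc k) \<omega>))"
    if \<omega>: "\<omega> \<in> space M" for \<omega>
  proof (cases "0 < D (X k \<omega>)")
    case True
    have "c1 * \<alpha> k * (v (I k \<omega>) (X k \<omega>) * d (X k \<omega>))
        = deriv \<phi> (D (X k \<omega>)) * (c1 * \<alpha> k * (v (I k \<omega>) (X k \<omega>) * (G (X k \<omega>))\<^sup>2))"
      using True by (simp add: d_def)
    also have "\<dots> \<le> deriv \<phi> (D (X k \<omega>)) * (D (X k \<omega>) - D (X (Suc k) \<omega>))"
      by (intro mult_left_mono sampled_descent \<omega> less_imp_le kl.deriv_pos True)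
    also have "\<dots> \<le> \<phi> (D (X k \<omega>)) - \<phi> (D (X (Suc k) \<omega>))"
      using kl.tangent[OF True D_nonneg, of "X (Suc k) \<omega>"] by (simp add: algebra_simps)
    finally show ?thesis .
  next
    case False
    then have "D (X (Suc k) \<omega>) = D (X k \<omega>)"
      using D_Suc_le[OF \<omega>, of k] D_nonneg[of "X (Suc k) \<omega>"] by linarith
    then show ?thesis
      using False by (simp add: d_def)
  qed
  have vd: "simple_function M (\<lambda>\<omega>. v (I k \<omega>) (X k \<omega>) * d (X k \<omega>))"
    by (rule simple_function_compose2[where h = "\<lambda>i x. v i x * d x",
          OF simple_function_M[OF I_simple] simple_function_M[OF X_simple]])
  have "\<rho> * (\<integral>\<omega>. \<mu> * G (X k \<omega>) \<partial>M) \<le> (\<integral>\<omega>. v (I k \<omega>) (X k \<omega>) * d (X k \<omega>) \<partial>M)"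
  proof (rule sampled_expectation_ge[where u = "\<lambda>i \<omega>. v i (X k \<omega>) * d (X k \<omega>)"])
    show "simple_function (\<F> k) (\<lambda>\<omega>. v i (X k \<omega>) * d (X k \<omega>))" for i
      by (rule simple_function_compose1[where g = "\<lambda>x. v i x * d x", OF X_simple])
    show "simple_function (\<F> k) (\<lambda>\<omega>. \<mu> * G (X k \<omega>))"
      by (rule simple_function_compose1[where g = "\<lambda>x. \<mu> * G x", OF X_simple])
    show "\<mu> * G (X k \<omega>) \<le> (\<Sum>i\<in>{1..m}. v i (X k \<omega>) * d (X k \<omega>))" for \<omega>
      unfolding sum_distrib_right[symmetric]
      using pos by (intro mult_mono v_sum d_ge G_nonneg order_trans[OF _ v_sum]) simp
  qed (use v_bounds d_nonneg in auto)
  then have "\<rho> * (\<mu> * (\<integral>\<omega>. G (X k \<omega>) \<partial>M)) \<le> (\<integral>\<omega>. v (I k \<omega>) (X k \<omega>) * d (X k \<omega>) \<partial>M)"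
    by simp
  then have "c1 * \<alpha> k * (\<rho> * (\<mu> * (\<integral>\<omega>. G (X k \<omega>) \<partial>M)))
      \<le> c1 * \<alpha> k * (\<integral>\<omega>. v (I k \<omega>) (X k \<omega>) * d (X k \<omega>) \<partial>M)"
    using pos step(1)[of k] by (intro mult_left_mono) auto
  also have "\<dots> = (\<integral>\<omega>. c1 * \<alpha> k * (v (I k \<omega>) (X k \<omega>) * d (X k \<omega>)) \<partial>M)"
    by simp
  also have "\<dots> \<le> (\<integral>\<omega>. \<phi> (D (X k \<omega>)) - \<phi> (D (X (Suc k) \<omega>)) \<partial>M)"
    by (intro integral_mono ineq integrable_mult_right simple_integrable[OF vd]
        Bochner_Integration.integrable_diff integrable_X)
  also have "\<dots> = mean_phi k - mean_phi (Suc k)"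
    unfolding mean_phi_def by (intro Bochner_Integration.integral_diff integrable_X)
  finally show ?thesis
    by (simp add: c2_def mult_ac)
qed

lemma simple_XX: "simple_function M (\<lambda>\<omega>. norm (X j \<omega> - X k \<omega>))"
  by (rule simple_function_compose2[where h = "\<lambda>x y. norm (x - y)",
        OF simple_function_M[OF X_simple] simple_function_M[OF X_simple]])

lemma mean_step_length_le:
  "(\<integral>\<omega>. norm (X (Suc k) \<omega> - X k \<omega>) \<partial>M) \<le> sqrt c3 / (c1 * c2) * (mean_phi k - mean_phi (Suc k))"
proof -
  have "(\<integral>\<omega>. norm (X (Suc k) \<omega> - X k \<omega>) \<partial>M) \<le> (\<integral>\<omega>. \<alpha> k * sqrt c3 * G (X k \<omega>) \<partial>M)"
  proof (rule integral_mono)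
    show "norm (X (Suc k) \<omega> - X k \<omega>) \<le> \<alpha> k * sqrt c3 * G (X k \<omega>)" if "\<omega> \<in> space M" for \<omega>
      using T_length_le I_in[OF that] by (simp add: X_Suc that)
  qed (intro simple_integrable[OF simple_XX] integrable_mult_right integrable_X)+
  also have "\<dots> = sqrt c3 / (c1 * c2) * (c1 * c2 * \<alpha> k * (\<integral>\<omega>. G (X k \<omega>) \<partial>M))"
    using pos c2_pos by simp
  also have "\<dots> \<le> sqrt c3 / (c1 * c2) * (mean_phi k - mean_phi (Suc k))"
    using pos c2_pos by (intro mult_left_mono mean_phi_decrease) auto
  finally show ?thesis .
qed

lemma mean_distance_le:
  assumes "k \<le> j"
  shows "(\<integral>\<omega>. norm (X k \<omega> - X j \<omega>) \<partial>M) \<le> sqrt c3 / (c1 * c2) * (mean_phi k - mean_phi j)"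
  using assms
proof (induction j rule: dec_induct)
  case (step j)
  have "(\<integral>\<omega>. norm (X k \<omega> - X (Suc j) \<omega>) \<partial>M)
      \<le> (\<integral>\<omega>. norm (X k \<omega> - X j \<omega>) + norm (X (Suc j) \<omega> - X j \<omega>) \<partial>M)"
  proof (rule integral_mono)
    show "norm (X k \<omega> - X (Suc j) \<omega>) \<le> norm (X k \<omega> - X j \<omega>) + norm (X (Suc j) \<omega> - X j \<omega>)" for \<omega>
      using norm_triangle_ineq4[of "X k \<omega> - X j \<omega>" "X (Suc j) \<omega> - X j \<omega>"] by simp
  qed (intro simple_integrable[OF simple_XX] Bochner_Integration.integrable_add)+
  also have "\<dots> = (\<integral>\<omega>. norm (X k \<omega> - X j \<omega>) \<partial>M) + (\<integral>\<omega>. norm (X (Suc j) \<omega> - X j \<omega>) \<partial>M)"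
    by (intro Bochner_Integration.integral_add simple_integrable[OF simple_XX])
  also have "\<dots> \<le> sqrt c3 / (c1 * c2) * (mean_phi k - mean_phi j)
      + sqrt c3 / (c1 * c2) * (mean_phi j - mean_phi (Suc j))"
    by (intro add_mono step.IH mean_step_length_le)
  finally show ?case by (simp add: algebra_simps)
qed simp

text \<open>The expected lengths telescope to a finite total, so almost every trajectory has finite
  length and is the partial sum of an absolutely convergent series.\<close>

lemma AE_convergent: "AE \<omega> in M. convergent (\<lambda>k. X k \<omega>)"
proof -
  have "AE \<omega> in M. summable (\<lambda>k. norm (X (Suc k) \<omega> - X k \<omega>))"
  proof (rule AE_summable_of_bounded_integrals[where B = "sqrt c3 / (c1 * c2) * mean_phi 0"])
    fix N
    have "(\<Sum>k<N. \<integral>\<omega>. norm (X (Suc k) \<omega> - X k \<omega>) \<partial>M)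
        \<le> (\<Sum>k<N. sqrt c3 / (c1 * c2) * (mean_phi k - mean_phi (Suc k)))"
      by (intro sum_mono mean_step_length_le)
    also have "\<dots> = sqrt c3 / (c1 * c2) * (mean_phi 0 - mean_phi N)"
      unfolding sum_distrib_left[symmetric] by (simp add: sum_lessThan_telescope')
    also have "\<dots> \<le> sqrt c3 / (c1 * c2) * mean_phi 0"
      using pos c2_pos mean_phi_nonneg[of N] by (intro mult_left_mono) auto
    finally show "(\<Sum>k<N. \<integral>\<omega>. norm (X (Suc k) \<omega> - X k \<omega>) \<partial>M) \<le> sqrt c3 / (c1 * c2) * mean_phi 0" .
  qed (auto intro: simple_integrable[OF simple_XX])
  then show ?thesis
  proof eventually_elim
    case (elim \<omega>)
    then have "summable (\<lambda>k. X (Suc k) \<omega> - X k \<omega>)"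
      by (rule summable_norm_cancel)
    then have "(\<lambda>n. X n \<omega> - X 0 \<omega>) \<longlonglongrightarrow> (\<Sum>k. X (Suc k) \<omega> - X k \<omega>)"
      unfolding sum_lessThan_telescope[of "\<lambda>k. X k \<omega>", symmetric] by (rule summable_LIMSEQ)
    then have "(\<lambda>n. (X n \<omega> - X 0 \<omega>) + X 0 \<omega>) \<longlonglongrightarrow> (\<Sum>k. X (Suc k) \<omega> - X k \<omega>) + X 0 \<omega>"
      by (intro tendsto_add tendsto_const)
    then show ?case
      by (auto intro: convergentI)
  qed
qed

section \<open>The almost sure limit and distances to it\<close>

definition limit :: "'w \<Rightarrow> 'a" where "limit \<omega> = lim (\<lambda>k. X k \<omega>)"

lemma limit_measurable [measurable]: "limit \<in> borel_measurable M"
  unfolding limit_def by measurable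

lemma AE_limit: "AE \<omega> in M. (\<lambda>k. X k \<omega>) \<longlonglongrightarrow> limit \<omega>"
  using AE_convergent by eventually_elim (simp add: limit_def convergent_LIMSEQ_iff)

lemma AE_eventually_le_rate_Suc: "AE \<omega> in M. \<exists>N. \<forall>k\<ge>N. D (X k \<omega>) \<le> rate (Suc k)"
  using AE_progress_eventually_ge AE_space by eventually_elim (rule eventually_le_rate_Suc)

lemma AE_limit_minimizes: "AE \<omega> in M. D (limit \<omega>) = 0"
  using AE_limit AE_eventually_le_rate_Suc
proof eventually_elim
  case (elim \<omega>)
  then obtain N where N: "\<And>k. k \<ge> N \<Longrightarrow> D (X k \<omega>) \<le> rate (Suc k)" by blast
  have "(\<lambda>k. D (X k \<omega>)) \<longlonglongrightarrow> D (limit \<omega>)"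
    by (rule continuous_on_tendsto_compose[OF D_cont elim(1)]) auto
  moreover have "\<exists>N. \<forall>k\<ge>N. D (X k \<omega>) \<le> e" if "0 < e" for e
  proof -
    obtain N' where N': "\<And>k. k \<ge> N' \<Longrightarrow> rate k \<le> e"
      using rate_eventually_le[OF \<open>0 < e\<close>] by blast
    have "D (X k \<omega>) \<le> e" if "k \<ge> max N N'" for k
      using N[of k] N'[of "Suc k"] that by simp
    then show ?thesis by blast
  qed
  ultimately have "D (limit \<omega>) \<le> 0 + e" if "0 < e" for e
    using that LIMSEQ_le_const2 by fastforce
  then have "D (limit \<omega>) \<le> 0"
    by (rule field_le_epsilon)
  then show ?case
    using D_nonneg[of "limit \<omega>"] by linarith
qed

text \<open>Iterates and almost every limit stay in the bounded initial sublevel set;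
  \<open>B\<close> provides the dominating constant for convergence in mean.\<close>

lemma bound_exists:
  obtains B where "\<And>k \<omega>. \<omega> \<in> space M \<Longrightarrow> norm (X k \<omega>) \<le> B" "AE \<omega> in M. norm (limit \<omega>) \<le> B"
proof -
  obtain B where B: "\<And>x. D x \<le> D x0 \<Longrightarrow> norm x \<le> B"
    using bounded_sublevel by (auto simp: bounded_iff)
  have "AE \<omega> in M. norm (limit \<omega>) \<le> B"
    using AE_limit_minimizes by eventually_elim (use B D_nonneg in auto)
  with B D_le_init that show ?thesis by blast
qed

lemma integrable_limit: "integrable M (\<lambda>\<omega>. X k \<omega> - limit \<omega>)"
proof -
  obtain B where "AE \<omega> in M. norm (limit \<omega>) \<le> B"
    using bound_exists by metis
  then have "integrable M limit"
    by (rule integrable_const_bound) measurable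
  then show ?thesis
    using integrable_X[of "\<lambda>x. x" k] by simp
qed

lemma limit_in_mean: "(\<lambda>k. \<integral>\<omega>. norm (X k \<omega> - limit \<omega>) \<partial>M) \<longlonglongrightarrow> 0"
proof -
  obtain B where B: "\<And>k \<omega>. \<omega> \<in> space M \<Longrightarrow> norm (X k \<omega>) \<le> B" "AE \<omega> in M. norm (limit \<omega>) \<le> B"
    using bound_exists by metis
  have "(\<lambda>k. \<integral>\<omega>. norm (X k \<omega> - limit \<omega>) \<partial>M) \<longlonglongrightarrow> (\<integral>\<omega>. 0 \<partial>M)"
  proof (rule integral_dominated_convergence[where w = "\<lambda>_. B + B"])
    show "AE \<omega> in M. (\<lambda>k. norm (X k \<omega> - limit \<omega>)) \<longlonglongrightarrow> 0"
      using AE_limit by eventually_elim (simp add: LIM_zero tendsto_norm_zero)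
    show "AE \<omega> in M. norm (norm (X k \<omega> - limit \<omega>)) \<le> B + B" for k
      using B(2) AE_space
    proof eventually_elim
      case (elim \<omega>)
      then show ?case
        using norm_triangle_ineq4[of "X k \<omega>" "limit \<omega>"] B(1)[of \<omega> k] by simp
    qed
  qed auto
  then show ?thesis by simp
qed

text \<open>Inserting a later iterate \<open>X j\<close> leaves a remainder that vanishes in mean as
  \<open>j\<close> grows; Jensen's inequality then replaces the mean of \<phi> by \<phi> of the
  mean.\<close>

lemma mean_distance_to_limit_le:
  "(\<integral>\<omega>. norm (X k \<omega> - limit \<omega>) \<partial>M) \<le> sqrt c3 / (c1 * c2) * \<phi> (\<integral>\<omega>. D (X k \<omega>) \<partial>M)"
proof -
  have C: "0 \<le> sqrt c3 / (c1 * c2)"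
    using pos c2_pos by simp
  have "(\<integral>\<omega>. norm (X k \<omega> - limit \<omega>) \<partial>M)
      \<le> sqrt c3 / (c1 * c2) * mean_phi k + (\<integral>\<omega>. norm (X j \<omega> - limit \<omega>) \<partial>M)" if "k \<le> j" for j
  proof -
    have "(\<integral>\<omega>. norm (X k \<omega> - limit \<omega>) \<partial>M)
        \<le> (\<integral>\<omega>. norm (X k \<omega> - X j \<omega>) + norm (X j \<omega> - limit \<omega>) \<partial>M)"
    proof (rule integral_mono)
      show "norm (X k \<omega> - limit \<omega>) \<le> norm (X k \<omega> - X j \<omega>) + norm (X j \<omega> - limit \<omega>)" for \<omega>
        using norm_triangle_ineq[of "X k \<omega> - X j \<omega>" "X j \<omega> - limit \<omega>"] by simp
    qed (intro simple_integrable[OF simple_XX] Bochner_Integration.integrable_add integrable_norm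
        integrable_limit)+
    also have "\<dots> = (\<integral>\<omega>. norm (X k \<omega> - X j \<omega>) \<partial>M) + (\<integral>\<omega>. norm (X j \<omega> - limit \<omega>) \<partial>M)"
      by (intro Bochner_Integration.integral_add simple_integrable[OF simple_XX] integrable_norm
        integrable_limit)
    also have "(\<integral>\<omega>. norm (X k \<omega> - X j \<omega>) \<partial>M) \<le> sqrt c3 / (c1 * c2) * (mean_phi k - mean_phi j)"
      by (rule mean_distance_le[OF that])
    also have "\<dots> \<le> sqrt c3 / (c1 * c2) * mean_phi k"
      using mean_phi_nonneg[of j] by (intro mult_left_mono C) simp
    finally show ?thesis by simp
  qed
  then have "(\<integral>\<omega>. norm (X k \<omega> - limit \<omega>) \<partial>M) \<le> sqrt c3 / (c1 * c2) * mean_phi k + 0"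
    by (intro LIMSEQ_le_const[OF tendsto_add[OF tendsto_const limit_in_mean]]) auto
  also have "\<dots> \<le> sqrt c3 / (c1 * c2) * \<phi> (\<integral>\<omega>. D (X k \<omega>) \<partial>M)"
    using mult_left_mono[OF mean_phi_le C] by simp
  finally show ?thesis .
qed

text \<open>Both estimates hold almost surely from a common index on; the least settling indices
  make the two times measurable.\<close>

lemma settling_times:
  obtains K2 K3 :: "'w \<Rightarrow> enat" where
    "K2 \<in> M \<rightarrow>\<^sub>M count_space UNIV" "K3 \<in> M \<rightarrow>\<^sub>M count_space UNIV"
    "AE \<omega> in M. K2 \<omega> < \<infinity> \<and> K3 \<omega> < \<infinity>"
    "\<And>k \<omega>. K2 \<omega> \<le> enat k \<Longrightarrow> D (X k \<omega>) \<le> rate k"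
    "\<And>k \<omega>. K3 \<omega> \<le> enat k \<Longrightarrow> norm (X k \<omega> - limit \<omega>) \<le> sqrt 2 / (c1 * sqrt c2) * \<phi> (rate k)"
proof -
  have [measurable]: "(\<lambda>\<omega>. D (X k \<omega>)) \<in> borel_measurable M" for k
    by (rule borel_measurable_simple_function[OF X_simple_M])
  have Q2: "Measurable.pred M (\<lambda>\<omega>. D (X k \<omega>) \<le> rate k)" for k
    by measurable
  have Q3: "Measurable.pred M (\<lambda>\<omega>. norm (X k \<omega> - limit \<omega>) \<le> sqrt 2 / (c1 * sqrt c2) * \<phi> (rate k))"
    for k by measurable
  obtain K2 :: "'w \<Rightarrow> enat" where K2: "K2 \<in> M \<rightarrow>\<^sub>M count_space UNIV"
    "\<And>\<omega>. \<exists>N. \<forall>k\<ge>N. D (X k \<omega>) \<le> rate k \<Longrightarrow> K2 \<omega> < \<infinity>"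
    "\<And>\<omega> k. K2 \<omega> \<le> enat k \<Longrightarrow> D (X k \<omega>) \<le> rate k"
    by (rule first_settling_time[OF Q2]) (rule that)
  obtain K3 :: "'w \<Rightarrow> enat" where K3: "K3 \<in> M \<rightarrow>\<^sub>M count_space UNIV"
    "\<And>\<omega>. \<exists>N. \<forall>k\<ge>N. norm (X k \<omega> - limit \<omega>) \<le> sqrt 2 / (c1 * sqrt c2) * \<phi> (rate k) \<Longrightarrow> K3 \<omega> < \<infinity>"
    "\<And>\<omega> k. K3 \<omega> \<le> enat k \<Longrightarrow> norm (X k \<omega> - limit \<omega>) \<le> sqrt 2 / (c1 * sqrt c2) * \<phi> (rate k)"
    by (rule first_settling_time[OF Q3]) (rule that)
  have "AE \<omega> in M. K2 \<omega> < \<infinity> \<and> K3 \<omega> < \<infinity>"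
    using AE_eventually_le_rate_Suc AE_limit AE_space
  proof eventually_elim
    case (elim \<omega>)
    then obtain N where N: "\<And>k. k \<ge> N \<Longrightarrow> D (X k \<omega>) \<le> rate (Suc k)" by blast
    have "\<forall>k\<ge>N. D (X k \<omega>) \<le> rate k"
      using N rate_antimono[OF le_SucI[OF order_refl]] order_trans by blast
    moreover have "\<forall>k\<ge>N. norm (X k \<omega> - limit \<omega>) \<le> sqrt 2 / (c1 * sqrt c2) * \<phi> (rate k)"
      using distance_le_rate[OF elim(3) N elim(2)] by blast
    ultimately show ?case
      using K2(2) K3(2) by blast
  qed
  with K2 K3 that show ?thesis by blast
qed

end

section \<open>Application to the block proximal-gradient method\<close>

theorem theorem11:
  fixes M :: "'w measure" and \<F> :: "nat \<Rightarrow> 'w measure"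
    and Def :: "nat \<Rightarrow> real list set set"
    and b :: "'n::finite \<Rightarrow> nat" and m :: nat
    and F R H :: "real ^ 'n \<Rightarrow> real" and Hmin :: real
    and x0 :: "real ^ 'n" and S :: "(real ^ 'n) set"
    and LF LR vrho Lh :: "nat \<Rightarrow> real"
    and \<alpha> A :: "nat \<Rightarrow> real" and abar \<rho> t0 c1 c2 c3 h :: real
    and I :: "nat \<Rightarrow> 'w \<Rightarrow> nat" and X :: "nat \<Rightarrow> 'w \<Rightarrow> real ^ 'n"
    and vphi phi :: "real \<Rightarrow> real" and psi :: "real \<Rightarrow> ereal" and psi_inv :: "ereal \<Rightarrow> real"
  assumes prob: "prob_space M"
    and filtr: "filtration (space M) \<F>" "\<And>k. subalgebra M (\<F> k)"
    and blocks: "range b = {1..m}"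
    and C1: "C1_fun F" "C1_fun R"
    and H_def: "H = (\<lambda>x. F x + R x)"
    and Hmin_def: "Hmin = (INF x. H x)"
    and S_def: "S = {x. H x \<le> H x0}"
    and H_coercive: "coercive H"
    and H_convex: "convex_on UNIV H"
    and H_definable: "o_minimal_structure Def" "definable_fun Def H"
    and H_grad: "locally_lipschitz (grad H)"
    and regular: "blockwise_regular b m F R S LF LR vrho"
    and Lh_def: "Lh = (\<lambda>i. LF i + vrho i)"
    and step: "\<And>k. 0 < \<alpha> k" "\<And>k. \<alpha> k \<le> abar"
    and abar_less: "ereal abar <
      min 2 (MIN i\<in>{1..m}. if vrho i = 0 then \<infinity> else ereal (Lh i / vrho i))"
    and step_sum: "(\<Sum>k. ereal (\<alpha> k)) = \<infinity>"
    and I_meas: "\<And>k. I k \<in> \<F> (Suc k) \<rightarrow>\<^sub>M count_space {1..m}"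
    and \<rho>_pos: "\<rho> > 0"
    and I_prob: "\<And>k i. i \<in> {1..m} \<Longrightarrow>
      AE \<omega> in M. real_cond_exp M (\<F> k) (indicat_real {\<omega> \<in> space M. I k \<omega> = i}) \<omega> \<ge> \<rho>"
    and X_0: "\<And>\<omega>. \<omega> \<in> space M \<Longrightarrow> X 0 \<omega> = x0"
    and X_Suc: "\<And>k \<omega>. \<omega> \<in> space M \<Longrightarrow>
      X (Suc k) \<omega> = block_prox_map b F R Lh (I k \<omega>) (X k \<omega>) (\<alpha> k)"
    and vphi: "global_KL_desingularization H vphi"
    and t0_pos: "t0 > 0"
    and phi_def: "phi = KL_phi vphi"
    and psi_def: "psi = KL_psi vphi t0"
    and psi_inv_def: "psi_inv = KL_psi_inv vphi t0"
    and c1_def: "c1 = (1 - abar / 2) * (MIN i\<in>{1..m}. Lh i)"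
    and c2_def: "c2 = \<rho> * (MIN i\<in>{1..m}. 1 / (Lh i + abar * LR i)\<^sup>2)"
    and c3_def: "c3 = (MAX i\<in>{1..m}. 1 / (Lh i - abar * vrho i)\<^sup>2)"
    and h_def: "h = (1 - ln 2) / 2"
    and A_def: "A = (\<lambda>k. \<Sum>i<k. \<alpha> i)"
  shows
    "integrable_near_0 (\<lambda>t. 1 / sqrt (phi t)) \<and>
     \<not> integrable_near_0 (\<lambda>t. 1 / phi t) \<and>
     (\<forall>k. integrable M (\<lambda>\<omega>. H (X k \<omega>) - Hmin)) \<and>
     (\<forall>k\<ge>1. (\<integral>\<omega>. H (X k \<omega>) - Hmin \<partial>M)
        \<le> exp (- h * (c2 / (c3 * abar)) * A k) * (H x0 - Hmin)
          + psi_inv (psi (H x0 - Hmin) + ereal (c1 * c2 / 2 * A k))) \<and>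
     (\<exists>xs. xs \<in> borel_measurable M \<and>
        (AE \<omega> in M. (\<lambda>k. X k \<omega>) \<longlonglongrightarrow> xs \<omega>) \<and>
        (\<forall>k. integrable M (\<lambda>\<omega>. X k \<omega> - xs \<omega>)) \<and>
        (\<lambda>k. \<integral>\<omega>. norm (X k \<omega> - xs \<omega>) \<partial>M) \<longlonglongrightarrow> 0 \<and>
        (AE \<omega> in M. is_arg_min H (\<lambda>x. x \<in> S) (xs \<omega>)) \<and>
        (\<forall>k. (\<integral>\<omega>. norm (X k \<omega> - xs \<omega>) \<partial>M)
           \<le> sqrt c3 / (c1 * c2) * vphi (\<integral>\<omega>. H (X k \<omega>) - Hmin \<partial>M)) \<and>
        (\<exists>K2 K3 :: 'w \<Rightarrow> enat.
           K2 \<in> M \<rightarrow>\<^sub>M count_space UNIV \<and> K3 \<in> M \<rightarrow>\<^sub>M count_space UNIV \<and>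
           (AE \<omega> in M. K2 \<omega> < \<infinity> \<and> K3 \<omega> < \<infinity>) \<and>
           (AE \<omega> in M.
              (\<forall>k. K2 \<omega> \<le> enat k \<longrightarrow>
                 H (X k \<omega>) - Hmin \<le> psi_inv (ereal (c1 * c2 / 2 * A k))) \<and>
              (\<forall>k. K3 \<omega> \<le> enat k \<longrightarrow>
                 norm (X k \<omega> - xs \<omega>)
                   \<le> sqrt 2 / (c1 * sqrt c2) * vphi (psi_inv (ereal (c1 * c2 / 2 * A k)))))))"
proof -
  define \<mu> where "\<mu> = (MIN i\<in>{1..m}. 1 / (Lh i + abar * LR i)\<^sup>2)"
  have abar: "0 < abar" "abar < 2"
    using step(1)[of 0] step(2)[of 0] abar_less by auto
  have abar_vrho: "abar * vrho i < Lh i" if i: "i \<in> {1..m}" for i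
  proof (cases "vrho i = 0")
    case True
    have "0 < LF i"
      using regular i by (auto simp: blockwise_regular_def)
    then show ?thesis
      using True by (simp add: Lh_def)
  next
    case False
    have "0 \<le> vrho i"
      using regular i by (auto simp: blockwise_regular_def)
    with False have vr: "0 < vrho i" by simp
    have "ereal abar < (MIN i\<in>{1..m}. if vrho i = 0 then \<infinity> else ereal (Lh i / vrho i))"
      using abar_less by (simp only: min_less_iff_conj)
    also have "\<dots> \<le> (if vrho i = 0 then \<infinity> else ereal (Lh i / vrho i))"
      using i by (intro Min_le) auto
    finally have "abar < Lh i / vrho i"
      using False by simp
    then show ?thesis
      using vr by (simp add: field_simps)
  qed
  interpret pb: block_composite b m F R H S x0 LF LR vrho Lh abar c1 \<mu> c3
    by (rule block_composite.intro[OF blocks C1 H_def S_def regular Lh_def abar abar_vrho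
          c1_def \<mu>_def c3_def])
  have G: "GDERIV H x :> grad H x" for x
    using pb.GDERIV_H[of x] by (simp add: pb.grad_H)
  have kl: "desingularizing vphi"
    by (rule global_KL_imp_desingularizing[OF vphi G H_grad H_coercive])
  obtain z where z: "\<And>x. H z \<le> H x"
    using coercive_attains_min[OF H_coercive pb.continuous_H] by blast
  have Hmin: "Hmin = H z"
    unfolding Hmin_def by (rule cInf_eq_minimum) (use z in auto)
  define w where "w i = 1 / (Lh i + abar * LR i)\<^sup>2" for i
  have w: "0 \<le> w i" for i
    by (simp add: w_def)
  \<comment> \<open>At a critical point the quotient would evaluate to \<open>0\<close> and violate
    the lower bound on the sum of shares; the value \<mu> respects both bounds, and the product with
    the squared gradient norm vanishes anyway.\<close>
  define v where "v i x = (if grad H x = 0 then \<mu>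
      else w i * (norm (block_grad b i H x) / norm (grad H x))\<^sup>2)" for i x
  have v_eq: "v i x * (norm (grad H x))\<^sup>2 = (norm (block_grad b i H x))\<^sup>2 / (Lh i + abar * LR i)\<^sup>2" for i x
    by (simp add: v_def w_def power_divide block_grad_def linear_0[OF linear_block_proj])
  have one_block: "\<exists>i. i \<in> {1..m}"
    using pb.blocks_nonempty by blast
  interpret rd: randomized_descent M vphi \<F> m \<rho> I X "\<lambda>k i x. block_prox_map b F R Lh i x (\<alpha> k)"
    x0 "\<lambda>x. H x - Hmin" "\<lambda>x. norm (grad H x)" v \<alpha> A abar c1 c2 c3 \<mu> t0
  proof (rule randomized_descent.intro[OF prob kl], unfold_locales)
    \<comment> \<open>If \<open>A\<close> stayed below \<open>C\<close>, the extended-real series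
      would be at most \<open>C\<close>, against \<open>step_sum\<close>.\<close>
    show "\<exists>k. C \<le> A k" for C
    proof (rule ccontr)
      assume "\<nexists>k. C \<le> A k"
      then have "(\<Sum>k<n. ereal (\<alpha> k)) \<le> ereal C" for n
        by (auto simp: A_def not_le intro: less_imp_le)
      then have "(\<Sum>k. ereal (\<alpha> k)) \<le> ereal C"
        by (intro suminf_bound) (auto simp: less_imp_le step(1))
      then show False
        by (simp add: step_sum)
    qed
    show "continuous_on UNIV (\<lambda>x. H x - Hmin)"
      by (intro continuous_intros pb.continuous_H)
    show "bounded {x. H x - Hmin \<le> H x0 - Hmin}"
      using coercive_bounded_sublevel[OF H_coercive, of "H x0"] by simp
    show "1 \<le> deriv vphi (H x - Hmin) * norm (grad H x)" if "0 < H x - Hmin" for x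
    proof -
      have "\<not> is_arg_min H (\<lambda>_. True) x"
        using that unfolding is_arg_min_def Hmin by auto
      then show ?thesis
        using vphi unfolding global_KL_desingularization_def Hmin_def by blast
    qed
    show "norm (grad H x) = 0" if "H x - Hmin = 0" for x
      using GDERIV_min_eq_0[OF G, of x] z that by (simp add: Hmin)
    show "0 \<le> v i x" for i x
      using w pb.\<mu>_pos by (simp add: v_def)
    show "v i x \<le> c3" if i: "i \<in> {1..m}" for i x
    proof (cases "grad H x = 0")
      case True
      then show ?thesis
        using pb.\<mu>_le[OF i] pb.weight_le_c3[OF i] by (simp add: v_def)
    next
      case False
      then have "norm (block_grad b i H x) / norm (grad H x) \<le> 1"
        using norm_block_proj_le[of b i "grad H x"] by (simp add: block_grad_def)
      then have "w i * (norm (block_grad b i H x) / norm (grad H x))\<^sup>2 \<le> w i * 1"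
        by (intro mult_left_mono w) (simp add: power_le_one)
      then show ?thesis
        using pb.weight_le_c3[OF i] False by (simp add: v_def w_def)
    qed
    show "\<mu> \<le> (\<Sum>i\<in>{1..m}. v i x)" for x
    proof (cases "grad H x = 0")
      case True
      have "1 * \<mu> \<le> real m * \<mu>"
        using one_block pb.\<mu>_pos by (intro mult_right_mono) auto
      then show ?thesis
        using True by (simp add: v_def)
    next
      case False
      have "\<mu> = (\<Sum>i\<in>{1..m}. \<mu> * (norm (block_grad b i H x) / norm (grad H x))\<^sup>2)"
        using False sum_norm_block_proj[of "{1..m}" b "grad H x"] blocks
        by (simp add: block_grad_def power_divide sum_distrib_left[symmetric] sum_divide_distrib[symmetric])
      also have "\<dots> \<le> (\<Sum>i\<in>{1..m}. w i * (norm (block_grad b i H x) / norm (grad H x))\<^sup>2)"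
        using pb.\<mu>_le by (intro sum_mono mult_right_mono) (auto simp: w_def)
      finally show ?thesis
        using False by (simp add: v_def)
    qed
    show "c1 / \<alpha> k * (norm (block_prox_map b F R Lh i x (\<alpha> k) - x))\<^sup>2
        \<le> (H x - Hmin) - (H (block_prox_map b F R Lh i x (\<alpha> k)) - Hmin)" if "i \<in> {1..m}" for k i x
      using pb.prox_map_bounds(1)[OF that step] by simp
    show "norm (block_prox_map b F R Lh i x (\<alpha> k) - x) \<le> \<alpha> k * sqrt c3 * norm (grad H x)"
      if "i \<in> {1..m}" for k i x
      using pb.prox_map_bounds(2)[OF that step] .
    show "c1 * \<alpha> k * (v i x * (norm (grad H x))\<^sup>2)
        \<le> (H x - Hmin) - (H (block_prox_map b F R Lh i x (\<alpha> k)) - Hmin)"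
      if "i \<in> {1..m}" "H x - Hmin \<le> H x0 - Hmin" for k i x
      using pb.prox_map_bounds(3)[OF that(1) step] that(2) by (simp add: v_eq S_def)
  qed (use filtration.space_F[OF filtr(1)] filtration.sets_F_mono[OF filtr(1)] filtr(2) I_meas I_prob X_0 X_Suc step \<rho>_pos pb.\<mu>_pos pb.c1_pos pb.c3_pos t0_pos A_def c2_def z Hmin
      in \<open>simp_all add: \<mu>_def\<close>)
  obtain K2 K3 where K: "K2 \<in> M \<rightarrow>\<^sub>M count_space UNIV" "K3 \<in> M \<rightarrow>\<^sub>M count_space UNIV"
    "AE \<omega> in M. K2 \<omega> < \<infinity> \<and> K3 \<omega> < \<infinity>"
    "\<And>k \<omega>. K2 \<omega> \<le> enat k \<Longrightarrow> H (X k \<omega>) - Hmin \<le> rd.rate k"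
    "\<And>k \<omega>. K3 \<omega> \<le> enat k \<Longrightarrow> norm (X k \<omega> - rd.limit \<omega>) \<le> sqrt 2 / (c1 * sqrt c2) * vphi (rd.rate k)"
    using rd.settling_times by blast
  have argmin: "AE \<omega> in M. is_arg_min H (\<lambda>x. x \<in> S) (rd.limit \<omega>)"
    using rd.AE_limit_minimizes
  proof eventually_elim
    case (elim \<omega>)
    then have "H (rd.limit \<omega>) = H z"
      by (simp add: Hmin)
    then show ?case
      using z by (simp add: is_arg_min_linorder S_def)
  qed
  have settled: "AE \<omega> in M.
      (\<forall>k. K2 \<omega> \<le> enat k \<longrightarrow> H (X k \<omega>) - Hmin \<le> rd.rate k) \<and>
      (\<forall>k. K3 \<omega> \<le> enat k \<longrightarrow>
        norm (X k \<omega> - rd.limit \<omega>) \<le> sqrt 2 / (c1 * sqrt c2) * vphi (rd.rate k))"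
    using K(4,5) by simp
  show ?thesis
    unfolding phi_def psi_def psi_inv_def h_def rd.rate_def[symmetric]
  proof (intro conjI exI[of _ rd.limit])
    show "\<forall>k. integrable M (\<lambda>\<omega>. H (X k \<omega>) - Hmin)"
      by (intro allI rd.integrable_X)
    show "\<exists>K2 K3 :: 'w \<Rightarrow> enat. K2 \<in> M \<rightarrow>\<^sub>M count_space UNIV \<and> K3 \<in> M \<rightarrow>\<^sub>M count_space UNIV \<and>
        (AE \<omega> in M. K2 \<omega> < \<infinity> \<and> K3 \<omega> < \<infinity>) \<and>
        (AE \<omega> in M. (\<forall>k. K2 \<omega> \<le> enat k \<longrightarrow> H (X k \<omega>) - Hmin \<le> rd.rate k) \<and>
          (\<forall>k. K3 \<omega> \<le> enat k \<longrightarrow>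
            norm (X k \<omega> - rd.limit \<omega>) \<le> sqrt 2 / (c1 * sqrt c2) * vphi (rd.rate k)))"
      by (rule exI[of _ K2], rule exI[of _ K3]) (intro conjI K(1-3) settled)
  qed (use rd.expected_gap_le rd.mean_distance_to_limit_le in
      \<open>auto intro: rd.kl.integrable_deriv rd.limit_measurable rd.AE_limit rd.integrable_limit
        rd.limit_in_mean argmin simp: rd.kl.not_integrable_deriv_squared\<close>)
qed

end
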